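(* Let $B$ be a complete ccc Boolean algebra. Then there are disjoint elements $d, m \in B$ such that $d \vee m = \mathbf{1}$ and (i) in the space $(B \upharpoonright d, \tau_s)$ the closure of every nonempty open set is the whole space; (ii) the Boolean algebra $B \upharpoonright m$ carries a strictly positive Maharam submeasure.
   Context: A Boolean algebra is ccc if every antichain (set of pairwise disjoint nonzero elements) is countable. For $a \in B$, $B \upharpoonright a = \{x \in B : x \le a\}$ is regarded as a Boolean algebra with unit $a$; the elements $d,m$ are allowed to be $\mathbf{0}$ (then the corresponding algebra is the one-element algebra). Algebraic convergence in a complete Boolean algebra $B$: a sequence $\langle a_n : n\in\omega\rangle$ converges to $\mathbf{0}$ if there is a decreasing sequence $b_0 \ge b_1 \ge \dots$ with $\bigwedge_n b_n = \mathbf{0}$ and $a_n \le b_n$ for all $n$; it converges to $a \in B$ if the sequence of symmetric differences $\langle a_n \vartriangle a : n \in \omega\rangle$ converges to $\mathbf{0}$. The order sequential topology $\tau_s$ on a complete Boolean algebra $B$ is defined by: the closure of $A \subset B$ is the smallest set $\overline{A} \supset A$ such that the limit of every (algebraically) convergent sequence of elements of $\overline{A}$ belongs to $\overline{A}$. On $B\upharpoonright d$, $\tau_s$ denotes the order sequential topology of the complete Boolean algebra $B \upharpoonright d$. A submeasure on $B$ is a nonnegative real valued function $\mu$ on $B$ with $\mu(\mathbf{0}) = 0$; $\mu(a) \le \mu(b)$ whenever $a \le b$; and $\mu(a \vee b) \le \mu(a) + \mu(b)$. It is strictly positive if $\mu(a) = 0$ only for $a = \mathbf{0}$. It is a Maharam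 submeasure if it is continuous: $\lim_n \mu(a_n) = 0$ for every decreasing sequence $\langle a_n : n \in \omega\rangle$ with $\bigwedge_n a_n = \mathbf{0}$. *)

theory Defs
  imports "HOL-Analysis.Abstract_Topology"
begin

text \<open>
  A complete Boolean algebra is a type of sort \<open>{boolean_algebra, complete_lattice}\<close>. The library
  class \<open>complete_boolean_algebra\<close> is not used: it requires complete distributivity, hence
  covers only the atomic algebras.

  The algebra \<open>B \<restriction> d\<close> has carrier \<open>{..d}\<close> and unit \<open>d\<close>; its order, zero, finite joins and
  meets, differences and infima of nonempty families are those of the ambient algebra.
\<close>

definition ccc :: "'a::boolean_algebra itself \<Rightarrow> bool" where
  "ccc _ \<longleftrightarrow>
     (\<forall>A::'a set. bot \<notin> A \<and> pairwise (\<lambda>x y. inf x y = bot) A \<longrightarrow> countable A)"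

definition symdiff :: "'a::boolean_algebra \<Rightarrow> 'a \<Rightarrow> 'a" where
  "symdiff a b = sup (a - b) (b - a)"

definition conv_zero :: "'a::{boolean_algebra,complete_lattice} \<Rightarrow> (nat \<Rightarrow> 'a) \<Rightarrow> bool" where
  "conv_zero d a \<longleftrightarrow> range a \<subseteq> {..d} \<and>
     (\<exists>b. range b \<subseteq> {..d} \<and> decseq b \<and> (INF n. b n) = bot \<and> (\<forall>n. a n \<le> b n))"

definition alg_conv :: "'a::{boolean_algebra,complete_lattice} \<Rightarrow> (nat \<Rightarrow> 'a) \<Rightarrow> 'a \<Rightarrow> bool" where
  "alg_conv d a x \<longleftrightarrow> range a \<subseteq> {..d} \<and> x \<in> {..d} \<and> conv_zero d (\<lambda>n. symdiff (a n) x)"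

definition lim_closed :: "'a::{boolean_algebra,complete_lattice} \<Rightarrow> 'a set \<Rightarrow> bool" where
  "lim_closed d C \<longleftrightarrow> (\<forall>a x. range a \<subseteq> C \<and> alg_conv d a x \<longrightarrow> x \<in> C)"

definition os_closure :: "'a::{boolean_algebra,complete_lattice} \<Rightarrow> 'a set \<Rightarrow> 'a set" where
  "os_closure d A = \<Inter>{C. A \<subseteq> C \<and> C \<subseteq> {..d} \<and> lim_closed d C}"

text \<open>The order sequential topology of \<open>B \<restriction> d\<close>: the closed sets are the fixed points of
  \<open>os_closure d\<close>.\<close>

definition tau_s :: "'a::{boolean_algebra,complete_lattice} \<Rightarrow> 'a topology" where
  "tau_s d = topology (\<lambda>U. U \<subseteq> {..d} \<and> os_closure d ({..d} - U) = {..d} - U)"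

lemma lim_closed_carrier: "lim_closed d {..d}"
  by (auto simp: lim_closed_def alg_conv_def)

lemma os_closure_subset: "A \<subseteq> {..d} \<Longrightarrow> os_closure d A \<subseteq> {..d}"
  using lim_closed_carrier by (auto simp: os_closure_def)

lemma os_closure_superset: "A \<subseteq> os_closure d A"
  by (auto simp: os_closure_def)

lemma lim_closed_os_closure: "lim_closed d (os_closure d A)"
  unfolding lim_closed_def
proof (intro allI impI)
  fix a x
  assume ax: "range a \<subseteq> os_closure d A \<and> alg_conv d a x"
  have "x \<in> C" if C: "A \<subseteq> C" "C \<subseteq> {..d}" "lim_closed d C" for C
  proof -
    have "os_closure d A \<subseteq> C" unfolding os_closure_def using C by (intro Inter_lower) simp
    with ax have "range a \<subseteq> C" by (meson order_trans)
    with ax C(3) show ?thesis unfolding lim_closed_def by metis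
  qed
  then show "x \<in> os_closure d A" by (simp add: os_closure_def)
qed

lemma os_closure_fixed_iff:
  assumes "A \<subseteq> {..d}"
  shows "os_closure d A = A \<longleftrightarrow> lim_closed d A"
proof
  assume "os_closure d A = A"
  then show "lim_closed d A" using lim_closed_os_closure[of d A] by simp
next
  assume "lim_closed d A"
  then have "os_closure d A \<subseteq> A" using assms by (auto simp: os_closure_def)
  then show "os_closure d A = A" using os_closure_superset[of A d] by blast
qed

lemma alg_conv_subseq:
  fixes r :: "nat \<Rightarrow> nat"
  assumes "alg_conv d a x" "strict_mono r"
  shows "alg_conv d (a \<circ> r) x"
proof -
  obtain b where b: "range b \<subseteq> {..d}" "decseq b" "(INF n. b n) = bot"
      "\<And>n. symdiff (a n) x \<le> b n"
    and ax: "range a \<subseteq> {..d}" "x \<in> {..d}" "range (\<lambda>n. symdiff (a n) x) \<subseteq> {..d}"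
    using assms(1) unfolding alg_conv_def conv_zero_def by blast
  have "symdiff ((a \<circ> r) n) x \<le> b n" for n
    using b(2) b(4)[of "r n"] seq_suble[OF assms(2), of n]
    by (auto simp: decseq_def intro: order_trans)
  with b ax show ?thesis
    unfolding alg_conv_def conv_zero_def by (auto simp: image_subset_iff)
qed

lemma lim_closed_Un:
  assumes "lim_closed d A" "lim_closed d C"
  shows "lim_closed d (A \<union> C)"
  unfolding lim_closed_def
proof (intro allI impI)
  fix a x
  assume ax: "range a \<subseteq> A \<union> C \<and> alg_conv d a x"
  have "(UNIV::nat set) = {n. a n \<in> A} \<union> {n. a n \<in> C}"
    using ax by auto
  then have "infinite {n. a n \<in> A} \<or> infinite {n. a n \<in> C}"
    by (metis finite_UnI infinite_UNIV_nat)
  then obtain D where D: "D = A \<or> D = C" "infinite {n. a n \<in> D}"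
    by blast
  obtain r :: "nat \<Rightarrow> nat" where r: "strict_mono r" "\<And>n. a (r n) \<in> D"
    using infinite_enumerate[OF D(2)] by auto
  have "alg_conv d (a \<circ> r) x" using alg_conv_subseq ax r(1) by blast
  moreover have "range (a \<circ> r) \<subseteq> D" using r(2) by auto
  ultimately have "x \<in> D" using D(1) assms unfolding lim_closed_def by blast
  then show "x \<in> A \<union> C" using D(1) by auto
qed

lemma istopology_tau_s:
  "istopology (\<lambda>U. U \<subseteq> {..d} \<and> os_closure d ({..d} - U) = {..d} - U)"
proof -
  have eq: "(\<lambda>U. U \<subseteq> {..d} \<and> os_closure d ({..d} - U) = {..d} - U) =
      (\<lambda>U. U \<subseteq> {..d} \<and> lim_closed d ({..d} - U))"
    by (simp add: os_closure_fixed_iff)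
  have "lim_closed d ({..d} - S \<inter> T)"
    if "lim_closed d ({..d} - S)" "lim_closed d ({..d} - T)" for S T
    using lim_closed_Un[OF that] by (simp add: Diff_Int)
  moreover have "lim_closed d ({..d} - \<Union>K)"
    if K: "\<forall>U\<in>K. lim_closed d ({..d} - U)" for K
    unfolding lim_closed_def
  proof (intro allI impI)
    fix a x
    assume ax: "range a \<subseteq> {..d} - \<Union>K \<and> alg_conv d a x"
    have "x \<notin> U" if U: "U \<in> K" for U
    proof -
      have "range a \<subseteq> {..d} - U" using ax U by auto
      moreover have "lim_closed d ({..d} - U)" using K U by blast
      ultimately have "x \<in> {..d} - U" using ax unfolding lim_closed_def by blast
      then show ?thesis by simp
    qed
    moreover have "x \<in> {..d}" using ax by (simp add: alg_conv_def)
    ultimately show "x \<in> {..d} - \<Union>K" by blast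
  qed
  ultimately show ?thesis
    unfolding eq istopology_def by (simp add: Sup_le_iff le_infI1)
qed

lemma openin_tau_s:
  "openin (tau_s d) U \<longleftrightarrow> U \<subseteq> {..d} \<and> os_closure d ({..d} - U) = {..d} - U"
  unfolding tau_s_def by (simp add: topology_inverse'[OF istopology_tau_s])

lemma topspace_tau_s: "topspace (tau_s d) = {..d}"
proof -
  have "lim_closed d {}" by (auto simp: lim_closed_def)
  then have "openin (tau_s d) {..d}"
    by (simp add: openin_tau_s os_closure_fixed_iff)
  then have "{..d} \<subseteq> topspace (tau_s d)" by (rule openin_subset)
  moreover have "topspace (tau_s d) \<subseteq> {..d}"
    using openin_topspace[of "tau_s d"] by (simp only: openin_tau_s)
  ultimately show ?thesis by (rule subset_antisym[rotated])
qed

lemma closedin_tau_s: "closedin (tau_s d) C \<longleftrightarrow> C \<subseteq> {..d} \<and> lim_closed d C"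
  by (auto simp: closedin_def topspace_tau_s openin_tau_s double_diff os_closure_fixed_iff)

lemma closure_of_tau_s:
  assumes "A \<subseteq> {..d}"
  shows "tau_s d closure_of A = os_closure d A"
proof (rule closure_of_unique)
  show "A \<subseteq> os_closure d A" by (rule os_closure_superset)
  show "closedin (tau_s d) (os_closure d A)"
    by (simp add: closedin_tau_s lim_closed_os_closure os_closure_subset assms)
  show "os_closure d A \<subseteq> T" if "A \<subseteq> T" "closedin (tau_s d) T" for T
    using that by (auto simp: closedin_tau_s os_closure_def)
qed

definition submeasure_on :: "'a::boolean_algebra \<Rightarrow> ('a \<Rightarrow> real) \<Rightarrow> bool" where
  "submeasure_on m \<mu> \<longleftrightarrow>
     (\<forall>a\<le>m. 0 \<le> \<mu> a) \<and> \<mu> bot = 0 \<and>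
     (\<forall>b\<le>m. \<forall>a\<le>b. \<mu> a \<le> \<mu> b) \<and>
     (\<forall>a\<le>m. \<forall>b\<le>m. \<mu> (sup a b) \<le> \<mu> a + \<mu> b)"

definition strictly_positive_on :: "'a::boolean_algebra \<Rightarrow> ('a \<Rightarrow> real) \<Rightarrow> bool" where
  "strictly_positive_on m \<mu> \<longleftrightarrow> (\<forall>a\<le>m. \<mu> a = 0 \<longrightarrow> a = bot)"

definition maharam_submeasure_on ::
    "'a::{boolean_algebra,complete_lattice} \<Rightarrow> ('a \<Rightarrow> real) \<Rightarrow> bool" where
  "maharam_submeasure_on m \<mu> \<longleftrightarrow> submeasure_on m \<mu> \<and>
     (\<forall>a. range a \<subseteq> {..m} \<and> decseq a \<and> (INF n. a n) = bot \<longrightarrow>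
          (\<lambda>n. \<mu> (a n)) \<longlonglongrightarrow> 0)"

end

(*
  Let m be the join of a maximal antichain of elements below which there is a strictly positive
  Maharam submeasure, and let d be its complement. If some nonempty open set is not dense in B|d,
  then a nonzero element below d is found that carries such a submeasure, as follows.

  If c forces an unbounded real, then every u in an open set U has u + c in the closure of U
  (+ is symmetric difference). Removing the largest such c keeps the failure of density and leaves
  a weakly distributive algebra. There the closure of a set consists of the limits of its
  sequences, so 0 has arbitrarily small downward closed open neighbourhoods, and every such U
  contains a V with V v V v V inside U v U. As U v U omits a prescribed element a, a
  Birkhoff-Kakutani construction yields a Maharam submeasure that is nonzero at a; it is strictly
  positive on the complement of its largest null element.
*)
theory Submission
  imports Defs
begin

section \<open>Symmetric differences and null sequences\<close>

text \<open>What can be had is a passage from three joins to two. Joining one member from each of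
  infinitely many triples gives an element T that is a limit of joins lying in U. T itself may leave
  U, but it exceeds one of these joins by a remainder that is already in U, so T lies in U v U. For
  this reason the final chain consists of the sets \<open>joins V\<close> and not of the V
  themselves.

  The number three comes from Birkhoff-Kakutani: a list cut at half of its weight falls into two
  lists and one entry between them.

  The form U v U also fits the failure of density. Let G be open, H the complement of its closure, u
  in G and v in H. A small downward closed W has W + u inside G and W + v inside H. If u + v were in
  W v W, it would be p + q with disjoint p and q in W, and q + u = p + v would lie in both G and
  H.\<close>

lemma inf_SUP_distrib:
  fixes a :: "'a::{boolean_algebra,complete_lattice}"
  shows "inf a (SUP i\<in>I. f i) = (SUP i\<in>I. inf a (f i))"
proof (rule antisym)
  \<comment> \<open>Meeting with \<open>a\<close> is left adjoint to joining with
    \<open>- a\<close>, hence preserves arbitrary joins.\<close>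
  have "f i \<le> sup (- a) (SUP i\<in>I. inf a (f i))" if "i \<in> I" for i
    using SUP_upper[OF that, of "\<lambda>i. inf a (f i)"] by (simp add: inf_commute[of a] flip: shunt1)
  then have "(SUP i\<in>I. f i) \<le> sup (- a) (SUP i\<in>I. inf a (f i))"
    by (rule SUP_least)
  then show "inf a (SUP i\<in>I. f i) \<le> (SUP i\<in>I. inf a (f i))"
    by (simp add: inf_commute[of a "Sup _"] shunt1)
  show "(SUP i\<in>I. inf a (f i)) \<le> inf a (SUP i\<in>I. f i)"
    by (rule SUP_least) (meson SUP_upper inf_mono order_refl)
qed

lemma compl_SUP:
  fixes f :: "'i \<Rightarrow> 'a::{boolean_algebra,complete_lattice}"
  shows "- (SUP i\<in>I. f i) = (INF i\<in>I. - f i)"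
proof (rule antisym)
  show "- (SUP i\<in>I. f i) \<le> (INF i\<in>I. - f i)"
    by (rule INF_greatest) (simp add: SUP_upper)
  have "(SUP i\<in>I. f i) \<le> - (INF i\<in>I. - f i)"
    by (rule SUP_least) (metis INF_lower compl_le_swap1)
  then show "(INF i\<in>I. - f i) \<le> - (SUP i\<in>I. f i)"
    by (simp add: compl_le_swap1)
qed

lemma sup_INF_distrib:
  fixes a :: "'a::{boolean_algebra,complete_lattice}"
  shows "sup a (INF i\<in>I. f i) = (INF i\<in>I. sup a (f i))"
proof -
  have "- (SUP i\<in>I. inf (- a) (- f i)) = - inf (- a) (SUP i\<in>I. - f i)"
    by (simp add: inf_SUP_distrib)
  then show ?thesis by (simp add: compl_SUP)
qed

lemma diff_le_iff_le_sup:
  fixes a :: "'a::boolean_algebra"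
  shows "a - b \<le> c \<longleftrightarrow> a \<le> sup b c"
  by (simp add: diff_eq shunt2)

lemma symdiff_le_iff: "symdiff a b \<le> c \<longleftrightarrow> a \<le> sup b c \<and> b \<le> sup a c"
  by (simp add: symdiff_def diff_le_iff_le_sup)

lemma symdiff_commute: "symdiff a b = symdiff b a"
  by (simp add: symdiff_def sup_commute)

lemma symdiff_triangle:
  fixes a :: "'a::boolean_algebra"
  shows "symdiff a c \<le> sup (symdiff a b) (symdiff b c)"
proof -
  have le: "x \<le> sup y (symdiff x y)" "y \<le> sup x (symdiff x y)" for x y :: 'a
    using symdiff_le_iff by blast+
  have "x \<le> sup z (sup (symdiff x y) (symdiff y z))" for x y z :: 'a
  proof -
    have "sup y (symdiff x y) \<le> sup (sup z (symdiff y z)) (symdiff x y)"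
      by (rule sup_mono[OF le(1) order_refl])
    from order_trans[OF le(1) this] show ?thesis by (simp add: ac_simps)
  qed
  from this[of a c b] this[of c a b] show ?thesis
    by (simp add: symdiff_le_iff symdiff_commute ac_simps)
qed

global_interpretation symdiff: abstract_boolean_algebra_sym_diff
  "inf :: 'a \<Rightarrow> _" sup uminus bot top "symdiff :: 'a::boolean_algebra \<Rightarrow> _"
  by (intro abstract_boolean_algebra_sym_diff.intro boolean_algebra.abstract_boolean_algebra_axioms
      abstract_boolean_algebra_sym_diff_axioms.intro) (simp add: symdiff_def diff_eq inf_commute)

lemma symdiff_translate [simp]: "symdiff (symdiff a c) (symdiff b c) = symdiff a b"
  by (metis symdiff.xor.assoc symdiff.xor.commute symdiff.xor_left_self)

lemma symdiff_le: "symdiff a b \<le> sup a b"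
  unfolding symdiff_le_iff by (metis sup_ge1 sup_ge2 le_supI2)

lemma symdiff_mono_left:
  fixes a :: "'a::boolean_algebra"
  assumes "a \<le> b"
  shows "symdiff a b = b - a" "symdiff b a = b - a"
  using assms by (auto simp: symdiff_def sup_absorb2 sup_absorb1 simp flip: diff_shunt_var)

lemma symdiff_sup_le:
  fixes a :: "'a::boolean_algebra"
  shows "symdiff (sup a c) (sup b c) \<le> symdiff a b"
proof -
  have "a \<le> sup b (symdiff a b)" "b \<le> sup a (symdiff a b)"
    using symdiff_le_iff by blast+
  then have "a \<le> sup c (sup b (symdiff a b))" "b \<le> sup c (sup a (symdiff a b))"
    by (auto intro: le_supI2)
  then show ?thesis unfolding symdiff_le_iff
    by (simp add: ac_simps le_supI2)
qed

definition null :: "(nat \<Rightarrow> 'a::{boolean_algebra,complete_lattice}) \<Rightarrow> bool" where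
  "null y \<longleftrightarrow> (\<exists>b. decseq b \<and> (INF n. b n) = bot \<and> (\<forall>n. y n \<le> b n))"

lemma null_mono: "null y \<Longrightarrow> (\<And>n. z n \<le> y n) \<Longrightarrow> null z"
  unfolding null_def by (meson order_trans)

lemma null_bot [simp]: "null (\<lambda>n. bot)"
  unfolding null_def by (rule exI[of _ "\<lambda>n. bot"]) (simp add: decseq_def)

lemma null_decseq: "decseq b \<Longrightarrow> (INF n. b n) = bot \<Longrightarrow> null b"
  unfolding null_def by blast

text \<open>Monotonicity decouples the indices: the infimum lies below
  \<open>sup (b m) (c n)\<close> for all \<open>m\<close> and \<open>n\<close>, and the two limits
  can be taken one after the other.\<close>

lemma decseq_INF_sup:
  fixes b c :: "nat \<Rightarrow> 'a::{boolean_algebra,complete_lattice}"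
  assumes "decseq b" "decseq c" "(INF n. b n) = bot" "(INF n. c n) = bot"
  shows "(INF n. sup (b n) (c n)) = bot"
proof -
  let ?x = "INF n. sup (b n) (c n)"
  have "?x \<le> sup (b m) (c n)" for m n
  proof -
    have "?x \<le> sup (b (max m n)) (c (max m n))" by (rule INF_lower) simp
    also have "\<dots> \<le> sup (b m) (c n)"
      using assms(1,2) by (intro sup_mono) (auto simp: decseq_def)
    finally show ?thesis .
  qed
  then have "?x \<le> (INF n. sup (b m) (c n))" for m by (rule INF_greatest)
  then have "?x \<le> b m" for m by (simp add: assms(4) flip: sup_INF_distrib)
  then have "?x \<le> (INF m. b m)" by (rule INF_greatest)
  then show ?thesis by (simp add: assms(3) bot_unique)
qed

lemma null_sup:
  assumes "null y" "null z"
  shows "null (\<lambda>n. sup (y n) (z n))"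
proof -
  obtain b c where "decseq b" "decseq c" "(INF n. b n) = bot" "(INF n. c n) = bot"
    "\<And>n. y n \<le> b n" "\<And>n. z n \<le> c n"
    using assms unfolding null_def by metis
  moreover from this have "decseq (\<lambda>n. sup (b n) (c n))"
    by (simp add: decseq_def le_supI1 le_supI2)
  ultimately show ?thesis unfolding null_def
    by (intro exI[of _ "\<lambda>n. sup (b n) (c n)"]) (auto simp: decseq_INF_sup le_supI1 le_supI2)
qed

text \<open>A bounding sequence can be cut down to \<open>d\<close> and still decreases to
  \<open>bot\<close>. So \<open>null\<close> needs no reference to \<open>d\<close>, and null
  sequences pass freely between relative algebras.\<close>

lemma conv_zero_iff: "conv_zero d y \<longleftrightarrow> range y \<subseteq> {..d} \<and> null y"
proof
  assume y: "range y \<subseteq> {..d} \<and> null y"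
  then obtain b where b: "decseq b" "(INF n. b n) = bot" "\<And>n. y n \<le> b n"
    unfolding null_def by metis
  have "(INF n. inf d (b n)) \<le> (INF n. b n)" by (rule INF_mono) (meson inf_le2 iso_tuple_UNIV_I)
  moreover have "decseq (\<lambda>n. inf d (b n))" using b(1) by (auto simp: decseq_def le_infI2)
  ultimately show "conv_zero d y" unfolding conv_zero_def using b y
    by (intro conjI exI[of _ "\<lambda>n. inf d (b n)"]) (auto simp: bot_unique image_subset_iff)
qed (auto simp: conv_zero_def null_def)

lemma alg_conv_iff:
  "alg_conv d s x \<longleftrightarrow> range s \<subseteq> {..d} \<and> x \<le> d \<and> null (\<lambda>n. symdiff (s n) x)"
proof -
  have "range (\<lambda>n. symdiff (s n) x) \<subseteq> {..d}" if "range s \<subseteq> {..d}" "x \<le> d"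
    using that by (auto simp: symdiff_le_iff image_subset_iff le_supI2)
  then show ?thesis by (auto simp: alg_conv_def conv_zero_iff)
qed

text \<open>Asking for a single term in \<open>U\<close> is enough: applied to subsequences, it
  forces all but finitely many terms into \<open>U\<close>.\<close>

lemma openin_tau_s_iff:
  "openin (tau_s d) U \<longleftrightarrow> U \<subseteq> {..d} \<and>
    (\<forall>s x. range s \<subseteq> {..d} \<and> x \<in> U \<and> null (\<lambda>n. symdiff (s n) x) \<longrightarrow> (\<exists>n. s n \<in> U))"
proof -
  have "openin (tau_s d) U \<longleftrightarrow> U \<subseteq> {..d} \<and> lim_closed d ({..d} - U)"
    by (simp add: openin_tau_s os_closure_fixed_iff)
  also have "\<dots> \<longleftrightarrow> U \<subseteq> {..d} \<and>
    (\<forall>s x. range s \<subseteq> {..d} \<and> x \<in> U \<and> null (\<lambda>n. symdiff (s n) x) \<longrightarrow> (\<exists>n. s n \<in> U))"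
    unfolding lim_closed_def alg_conv_iff by blast
  finally show ?thesis .
qed

lemma openin_tau_s_seq:
  assumes "openin (tau_s d) U" "\<And>n. s n \<le> d" "x \<in> U" "null (\<lambda>n. symdiff (s n) x)"
  obtains n where "s n \<in> U"
  using assms unfolding openin_tau_s_iff by blast

lemma openin_tau_s_le: "openin (tau_s d) U \<Longrightarrow> x \<in> U \<Longrightarrow> x \<le> d"
  unfolding openin_tau_s_iff by blast

text \<open>Maps that do not increase symmetric differences are continuous, also between different
  relative algebras. They are applied as translations and as joins with a fixed element.\<close>

lemma openin_tau_s_vimage:
  assumes "openin (tau_s d) U" "\<And>x. x \<le> e \<Longrightarrow> h x \<le> d"
    "\<And>x y. symdiff (h x) (h y) \<le> symdiff x y"
  shows "openin (tau_s e) {x. x \<le> e \<and> h x \<in> U}"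
  unfolding openin_tau_s_iff
proof safe
  fix s x
  assume s: "range s \<subseteq> {..e}" "null (\<lambda>n. symdiff (s n) x)" and x: "x \<le> e" "h x \<in> U"
  have "null (\<lambda>n. symdiff (h (s n)) (h x))"
    using s(2) assms(3) by (rule null_mono)
  moreover have "h (s n) \<le> d" for n using s(1) assms(2) by auto
  ultimately obtain n where "h (s n) \<in> U" using openin_tau_s_seq[OF assms(1) _ x(2)] by metis
  then show "\<exists>n. s n \<in> {x. x \<le> e \<and> h x \<in> U}" using s(1) by auto
qed

section \<open>Maximal antichains and the countable chain condition\<close>

text \<open>Zorn yields a maximal antichain of nonzero members of \<open>P\<close>. A
  \<open>p\<close> not below its join would leave \<open>p - Sup A\<close>, a further member of
  \<open>P\<close> disjoint from all of \<open>A\<close>. Under ccc this makes the join of a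
  downward closed set a countable one.\<close>

lemma disjoint_cover:
  fixes P :: "'a::{boolean_algebra,complete_lattice} set"
  assumes down: "\<And>x y. x \<in> P \<Longrightarrow> y \<le> x \<Longrightarrow> y \<in> P"
  obtains A where "A \<subseteq> P" "bot \<notin> A" "pairwise (\<lambda>x y. inf x y = bot) A" "\<And>p. p \<in> P \<Longrightarrow> p \<le> Sup A"
proof -
  let ?F = "{A. A \<subseteq> P - {bot} \<and> pairwise (\<lambda>x y. inf x y = bot) A}"
  have "\<exists>M\<in>?F. \<forall>X\<in>?F. M \<subseteq> X \<longrightarrow> X = M"
  proof (rule subset_Zorn')
    fix C assume C: "subset.chain ?F C"
    have "pairwise (\<lambda>x y. inf x y = bot) (\<Union>C)"
    proof (rule pairwiseI)
      fix x y assume xy: "x \<in> \<Union>C" "y \<in> \<Union>C" "x \<noteq> y"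
      then obtain X Y where XY: "x \<in> X" "X \<in> C" "y \<in> Y" "Y \<in> C" by blast
      then have "X \<subseteq> Y \<or> Y \<subseteq> X" using C by (meson subset_chain_def)
      then obtain Z where "x \<in> Z" "y \<in> Z" "Z \<in> C" using XY by blast
      moreover have "Z \<in> ?F" using C \<open>Z \<in> C\<close> by (auto simp: subset_chain_def)
      ultimately show "inf x y = bot" using xy(3) by (simp add: pairwise_def)
    qed
    then show "\<Union>C \<in> ?F" using C unfolding subset_chain_def by blast
  qed
  then obtain A where AF: "A \<in> ?F" and maxF: "\<forall>X\<in>?F. A \<subseteq> X \<longrightarrow> X = A" ..
  from AF have A: "A \<subseteq> P - {bot}" "pairwise (\<lambda>x y. inf x y = bot) A" by simp_all
  have max: "X = A" if "X \<subseteq> P - {bot}" "pairwise (\<lambda>x y. inf x y = bot) X" "A \<subseteq> X" for X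
    using maxF that by simp
  have "p \<le> Sup A" if p: "p \<in> P" for p
  proof (rule ccontr)
    assume "\<not> p \<le> Sup A"
    then have q: "p - Sup A \<noteq> bot" by simp
    have disj: "inf (p - Sup A) a = bot" if "a \<in> A" for a
    proof -
      have "inf (p - Sup A) a \<le> inf (- Sup A) (Sup A)"
        by (rule inf_mono) (auto simp: diff_eq Sup_upper that)
      then show ?thesis by (simp add: bot_unique)
    qed
    have "p - Sup A \<in> P" using down[OF p] by (simp add: diff_eq)
    with disj q A have "insert (p - Sup A) A = A"
      by (intro max) (auto simp: pairwise_insert inf_commute)
    then have "p - Sup A \<in> A" by blast
    then show False using disj q by fastforce
  qed
  with A show ?thesis by (intro that[of A]) auto
qed

lemma ccc_countable:
  assumes "ccc TYPE('a::boolean_algebra)" "(bot::'a) \<notin> A" "pairwise (\<lambda>x y. inf x y = bot) A"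
  shows "countable A"
  using assms unfolding ccc_def by blast

text \<open>Refine the complements of the members of \<open>A\<close> to an antichain with the same
  join. It is countable, and one member of \<open>A\<close> is chosen for each of its
  elements.\<close>

lemma ccc_countable_Inf:
  fixes A :: "'a::{boolean_algebra,complete_lattice} set"
  assumes ccc: "ccc TYPE('a)"
  obtains C where "countable C" "C \<subseteq> A" "Inf C = Inf A"
proof -
  obtain D where D: "D \<subseteq> {x. \<exists>a\<in>A. x \<le> - a}" "bot \<notin> D" "pairwise (\<lambda>x y. inf x y = bot) D"
    and sup: "\<And>p. p \<in> {x. \<exists>a\<in>A. x \<le> - a} \<Longrightarrow> p \<le> Sup D"
    by (rule disjoint_cover[of "{x. \<exists>a\<in>A. x \<le> - a}"]) (auto intro: order_trans)
  have "\<forall>x\<in>D. \<exists>a\<in>A. x \<le> - a" using D(1) by blast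
  then obtain g where g: "\<And>x. x \<in> D \<Longrightarrow> g x \<in> A \<and> x \<le> - g x" by metis
  have "Inf (g ` D) \<le> a" if "a \<in> A" for a
  proof -
    have "x \<le> - Inf (g ` D)" if "x \<in> D" for x
      using g[OF that] by (meson INF_lower compl_mono order_trans that)
    then have "Sup D \<le> - Inf (g ` D)" by (rule Sup_least)
    with sup[of "- a"] that show ?thesis
      by (metis (mono_tags, lifting) compl_le_compl_iff mem_Collect_eq order_refl order_trans)
  qed
  then have "Inf (g ` D) = Inf A"
    by (intro antisym Inf_greatest Inf_superset_mono) (use g in auto)
  with ccc_countable[OF ccc D(2,3)] g show ?thesis by (intro that[of "g ` D"]) auto
qed

section \<open>Weak distributivity\<close>

lemma null_SUP_incseq:
  fixes c :: "nat \<Rightarrow> 'a::{boolean_algebra,complete_lattice}"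
  assumes "incseq c"
  shows "null (\<lambda>n. (SUP n. c n) - c n)"
proof (rule null_decseq)
  let ?S = "SUP n. c n"
  show "decseq (\<lambda>n. ?S - c n)"
    using assms by (auto simp: decseq_def incseq_def diff_eq intro: le_infI2)
  have "(INF n. ?S - c n) \<le> inf ?S (INF n. - c n)"
    by (intro le_infI INF_lower2[OF UNIV_I, of _ 0] INF_mono') (auto simp: diff_eq)
  then show "(INF n. ?S - c n) = bot"
    by (simp add: bot_unique flip: compl_SUP)
qed

text \<open>For \<open>c \<noteq> bot\<close> this expresses that \<open>c\<close> forces an unbounded real; weak distributivity
  is the absence of such elements.\<close>

definition unbounding :: "'a::{boolean_algebra,complete_lattice} \<Rightarrow> bool" where
  "unbounding c \<longleftrightarrow> (\<exists>b :: nat \<Rightarrow> nat \<Rightarrow> 'a.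
     (\<forall>n. decseq (b n) \<and> (INF k. b n k) = bot) \<and> (\<forall>f. (SUP n. b n (f n)) = c))"

definition weakly_distributive :: "'a::{boolean_algebra,complete_lattice} \<Rightarrow> bool" where
  "weakly_distributive e \<longleftrightarrow> (\<forall>c\<le>e. unbounding c \<longrightarrow> c = bot)"

lemma decseq_inf_INF:
  fixes b :: "nat \<Rightarrow> 'a::{boolean_algebra,complete_lattice}"
  assumes "decseq b" "(INF k. b k) = bot"
  shows "decseq (\<lambda>k. inf x (b k))" "(INF k. inf x (b k)) = bot"
proof -
  show "decseq (\<lambda>k. inf x (b k))" using assms(1) by (auto simp: decseq_def le_infI2)
  have "(INF k. inf x (b k)) \<le> (INF k. b k)"
    by (intro INF_mono') simp
  then show "(INF k. inf x (b k)) = bot" by (simp add: assms(2) bot_unique)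
qed

lemma unbounding_le:
  fixes c :: "'a::{boolean_algebra,complete_lattice}"
  assumes "unbounding c" "x \<le> c"
  shows "unbounding x"
proof -
  obtain b :: "nat \<Rightarrow> nat \<Rightarrow> 'a" where b: "\<And>n. decseq (b n)" "\<And>n. (INF k. b n k) = bot"
    "\<And>f. (SUP n. b n (f n)) = c"
    using assms(1) unfolding unbounding_def by metis
  have "(SUP n. inf x (b n (f n))) = x" for f
    using assms(2) by (simp add: b(3) inf_absorb1 flip: inf_SUP_distrib)
  with b show ?thesis unfolding unbounding_def
    by (intro exI[of _ "\<lambda>n k. inf x (b n k)"]) (simp add: decseq_inf_INF)
qed

text \<open>The matrices of the members are joined entry by entry. By disjointness, meeting with one
  member recovers its own matrix, so the rows still decrease to \<open>bot\<close>.\<close>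

lemma unbounding_Sup:
  fixes A :: "'a::{boolean_algebra,complete_lattice} set"
  assumes "\<And>a. a \<in> A \<Longrightarrow> unbounding a" "pairwise (\<lambda>x y. inf x y = bot) A"
  shows "unbounding (Sup A)"
proof -
  obtain B :: "'a \<Rightarrow> nat \<Rightarrow> nat \<Rightarrow> 'a" where B: "\<And>a n. a \<in> A \<Longrightarrow> decseq (B a n)" "\<And>a n. a \<in> A \<Longrightarrow> (INF k. B a n k) = bot"
    "\<And>a f. a \<in> A \<Longrightarrow> (SUP n. B a n (f n)) = a"
    using assms(1) unfolding unbounding_def by metis
  have le: "B a n k \<le> a" if "a \<in> A" for a n k
    using B(3)[OF that, of "\<lambda>_. k"] by (metis SUP_upper UNIV_I)
  let ?b = "\<lambda>n k. SUP a\<in>A. B a n k"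
  have 1: "decseq (?b n)" for n
    using B(1) by (auto simp: decseq_def intro!: SUP_subset_mono)
  have 2: "(INF k. ?b n k) = bot" for n
  proof -
    let ?x = "INF k. ?b n k"
    have "inf ?x a = bot" if a: "a \<in> A" for a
    proof -
      have "inf ?x a \<le> B a n k" for k
      proof -
        have "inf a (B a' n k) \<le> B a n k" if "a' \<in> A" for a'
        proof (cases "a' = a")
          case False
          then have "inf a a' = bot" using a that assms(2) by (auto simp: pairwise_def)
          then have "inf a (B a' n k) = bot"
            using le[OF that] by (metis bot_unique inf_mono order_refl)
          then show ?thesis by simp
        qed simp
        then have "inf a (?b n k) \<le> B a n k"
          by (simp add: inf_SUP_distrib SUP_least)
        moreover have "inf ?x a \<le> inf a (?b n k)"
        proof -
          have "?x \<le> ?b n k" by (rule INF_lower) simp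
          then show ?thesis by (simp add: le_infI1)
        qed
        ultimately show ?thesis by (rule order_trans[rotated])
      qed
      then have "inf ?x a \<le> (INF k. B a n k)" by (rule INF_greatest)
      then show ?thesis by (simp add: B(2)[OF a] bot_unique)
    qed
    then have "inf ?x (SUP a\<in>A. a) = bot"
      by (simp only: inf_SUP_distrib) (simp add: SUP_least flip: bot_unique)
    moreover have "?x \<le> (SUP a\<in>A. a)"
      by (rule INF_lower2[of 0]) (auto intro!: SUP_least intro: order_trans[OF le] Sup_upper)
    ultimately show ?thesis by (simp add: inf_absorb1)
  qed
  have 3: "(SUP n. ?b n (f n)) = Sup A" for f
    by (subst SUP_commute) (simp add: B(3))
  show ?thesis unfolding unbounding_def
    by (rule exI[of _ ?b], intro conjI allI 1 2 3)
qed

lemma greatest_unbounding: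
  obtains w :: "'a::{boolean_algebra,complete_lattice}"
    where "unbounding w" "weakly_distributive (- w)"
proof -
  obtain A where A: "A \<subseteq> Collect unbounding" "pairwise (\<lambda>x y. inf x y = bot) A"
    and max: "\<And>p. p \<in> Collect unbounding \<Longrightarrow> p \<le> Sup (A::'a set)"
    by (rule disjoint_cover[of "Collect unbounding"]) (auto intro: unbounding_le)
  have "c = bot" if "c \<le> - Sup A" "unbounding c" for c
  proof -
    have "c \<le> inf (- Sup A) (Sup A)" using max[of c] that by (intro le_infI) simp_all
    then show ?thesis by (simp only: boolean_algebra.conj_cancel_left bot_unique)
  qed
  with unbounding_Sup[of A] A show ?thesis
    by (intro that[of "Sup A"]) (auto simp: weakly_distributive_def)
qed

lemma weakly_distributive_le: "weakly_distributive e \<Longrightarrow> e' \<le> e \<Longrightarrow> weakly_distributive e'"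
  unfolding weakly_distributive_def by (meson order_trans)

text \<open>Start at \<open>u\<close> and add one entry of each row of the matrix, far enough out to stay inside the
  open set; the sum over all rows is \<open>c\<close>, whichever entries were used.\<close>

lemma unbounding_closure:
  fixes c :: "'a::{boolean_algebra,complete_lattice}"
  assumes U: "openin (tau_s d) U" "u \<in> U" and c: "unbounding c" "c \<le> d"
  shows "symdiff u c \<in> tau_s d closure_of U"
proof -
  obtain b :: "nat \<Rightarrow> nat \<Rightarrow> 'a" where b: "\<And>n. decseq (b n)" "\<And>n. (INF k. b n k) = bot"
    "\<And>f. (SUP n. b n (f n)) = c"
    using c(1) unfolding unbounding_def by metis
  have bc: "b n k \<le> c" for n k
    using b(3)[of "\<lambda>_. k"] by (metis SUP_upper UNIV_I)
  have ud: "u \<le> d" using U by (rule openin_tau_s_le)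
  have sd: "symdiff u x \<le> d" if "x \<le> c" for x
    using ud that c(2) by (meson le_sup_iff order_trans symdiff_le)
  let ?P = "\<lambda>n x. x \<le> c \<and> symdiff u x \<in> U"
  let ?Q = "\<lambda>n x y. \<exists>k. y = sup x (b n k)"
  have "\<exists>s. \<forall>n. ?P n (s n) \<and> ?Q n (s n) (s (Suc n))"
  proof (rule dependent_nat_choice)
    show "\<exists>x. ?P 0 x" using U(2) by (intro exI[of _ bot]) simp
    fix x n assume x: "?P n x"
    have "null (\<lambda>k. symdiff (symdiff u (sup x (b n k))) (symdiff u x))"
    proof (rule null_mono)
      show "null (b n)" using b(1,2) by (rule null_decseq)
      show "symdiff (symdiff u (sup x (b n k))) (symdiff u x) \<le> b n k" for k
        by (simp add: symdiff_commute[of u] symdiff_le_iff le_supI1)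
    qed
    then obtain k where "symdiff u (sup x (b n k)) \<in> U"
      using x bc by (elim openin_tau_s_seq[OF U(1), rotated 2]) (auto intro!: sd)
    with x bc show "\<exists>y. ?P (Suc n) y \<and> ?Q n x y" by (intro exI[of _ "sup x (b n k)"]) auto
  qed
  then obtain s where s: "\<And>n. s n \<le> c" "\<And>n. symdiff u (s n) \<in> U" "\<And>n. \<exists>k. s (Suc n) = sup (s n) (b n k)"
    by blast
  then obtain f where f: "\<And>n. s (Suc n) = sup (s n) (b n (f n))" by metis
  have inc: "incseq s" by (rule incseq_SucI) (simp add: f)
  have "c \<le> (SUP n. s n)" unfolding b(3)[of f, symmetric]
    by (intro SUP_least) (metis SUP_upper UNIV_I f le_sup_iff)
  then have sc: "(SUP n. s n) = c" using s(1) by (intro antisym SUP_least)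
  have lim: "null (\<lambda>n. symdiff (symdiff u (s n)) (symdiff u c))"
    using null_SUP_incseq[OF inc] s(1)
    by (simp add: sc symdiff_commute[of u] symdiff_mono_left)
  show ?thesis unfolding in_closure_of topspace_tau_s
  proof (intro conjI allI impI)
    show "symdiff u c \<in> {..d}" using sd by simp
    fix V assume V: "symdiff u c \<in> V \<and> openin (tau_s d) V"
    obtain n where "symdiff u (s n) \<in> V"
      using openin_tau_s_seq[OF _ _ _ lim] V sd s(1) by metis
    then show "\<exists>y. y \<in> U \<and> y \<in> V" using s(2) by blast
  qed
qed

text \<open>The infimum of \<open>S f\<close> over all \<open>f\<close> carries the matrix cut down
  to it, hence is \<open>unbounding\<close> and so \<open>bot\<close>. By ccc countably many
  \<open>f\<close> already have this infimum, and a \<open>g\<close> that eventually dominates each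
  of them works.\<close>

lemma null_diagonal:
  fixes b :: "nat \<Rightarrow> nat \<Rightarrow> 'a::{boolean_algebra,complete_lattice}"
  assumes ccc: "ccc TYPE('a)" and wd: "weakly_distributive e"
    and b: "\<And>n. decseq (b n)" "\<And>n. (INF k. b n k) = bot" "\<And>n k. b n k \<le> e"
  obtains g where "null (\<lambda>n. b n (g n))"
proof -
  define S where "S f = (SUP n. b n (f n))" for f
  let ?c = "INF f. S f"
  have "unbounding ?c" unfolding unbounding_def
  proof (intro exI[of _ "\<lambda>n k. inf ?c (b n k)"] conjI allI)
    show "(SUP n. inf ?c (b n (f n))) = ?c" for f
    proof -
      have "?c \<le> S f" by (rule INF_lower) simp
      then show ?thesis by (simp add: inf_absorb1 S_def flip: inf_SUP_distrib)
    qed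
  qed (rule decseq_inf_INF b)+
  moreover have "?c \<le> e"
    by (rule INF_lower2[of id]) (auto simp: S_def intro: SUP_least b(3))
  ultimately have c: "?c = bot" using wd by (simp add: weakly_distributive_def)
  obtain C where C: "countable C" "C \<subseteq> range S" "Inf C = bot"
    using ccc_countable_Inf[OF ccc, of "range S"] c by metis
  then obtain D where D: "countable D" "C = S ` D"
    by (metis countable_subset_image)
  \<comment> \<open>Inserting \<open>id\<close> makes the enumerated set nonempty.\<close>
  define F where "F = from_nat_into (insert id D)"
  have F: "range F = insert id D" unfolding F_def
    using D(1) by (intro range_from_nat_into) auto
  \<comment> \<open>From index \<open>i\<close> on, \<open>g\<close> is at least \<open>F i\<close>,
    so the tail of the diagonal from \<open>i\<close> lies below \<open>S (F i)\<close>.\<close>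
  define g where "g n = Max ((\<lambda>i. F i n) ` {..n})" for n
  have bg: "b n (g n) \<le> b n (F i n)" if "i \<le> n" for i n
    using that by (intro decseqD[OF b(1)]) (auto simp: g_def)
  define t where "t m = (SUP n\<in>{m..}. b n (g n))" for m
  have "decseq t" unfolding t_def decseq_def by (auto intro: SUP_subset_mono)
  moreover have "(INF m. t m) = bot"
  proof -
    have "(INF m. t m) \<le> x" if xC: "x \<in> C" for x
    proof -
      obtain f where f: "f \<in> D" "x = S f" using xC D(2) by blast
      have "f \<in> range F" using f(1) F by blast
      then obtain i where i: "x = S (F i)" using f(2) by blast
      show ?thesis unfolding i
        by (rule INF_lower2[of i]) (auto simp: t_def S_def intro!: SUP_subset_mono bg)
    qed
    then have "(INF m. t m) \<le> Inf C" by (rule Inf_greatest)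
    then show ?thesis by (simp add: C bot_unique)
  qed
  ultimately have "null t" by (rule null_decseq)
  then have "null (\<lambda>n. b n (g n))" by (rule null_mono) (auto simp: t_def intro: SUP_upper)
  then show ?thesis by (rule that)
qed

section \<open>Closure by a single passage to limits, and downward closed neighbourhoods of
  zero\<close>

definition seq_limits :: "'a::{boolean_algebra,complete_lattice} \<Rightarrow> 'a set \<Rightarrow> 'a set" where
  "seq_limits e A = {x. x \<le> e \<and> (\<exists>s. range s \<subseteq> A \<and> null (\<lambda>n. symdiff (s n) x))}"

text \<open>For a limit of limits, the bounds of the inner sequences form a matrix. A null diagonal
  of it selects one term of each inner sequence, and the triangle inequality adds the two
  errors.\<close>

lemma lim_closed_seq_limits:
  fixes A :: "'a::{boolean_algebra,complete_lattice} set"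
  assumes ccc: "ccc TYPE('a)" and wd: "weakly_distributive e" and A: "A \<subseteq> {..e}"
  shows "lim_closed e (seq_limits e A)"
  unfolding lim_closed_def alg_conv_iff
proof (intro allI impI, elim conjE)
  fix s x assume s: "range s \<subseteq> seq_limits e A" and x: "x \<le> e" "null (\<lambda>n. symdiff (s n) x)"
  have "\<exists>t. range t \<subseteq> A \<and> null (\<lambda>k. symdiff (t k) (s n))" for n
    using s unfolding seq_limits_def by blast
  then obtain t where t: "\<And>n. range (t n) \<subseteq> A" "\<And>n. null (\<lambda>k. symdiff (t n k) (s n))"
    by metis
  then obtain b :: "nat \<Rightarrow> nat \<Rightarrow> 'a" where b: "\<And>n. decseq (b n)" "\<And>n. (INF k. b n k) = bot"
    "\<And>n k. symdiff (t n k) (s n) \<le> b n k"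
    unfolding null_def by metis
  \<comment> \<open>\<open>null_diagonal\<close> wants entries below \<open>e\<close>. The cut loses
    nothing, since the differences to be bounded lie below \<open>e\<close>.\<close>
  obtain g where g: "null (\<lambda>n. inf e (b n (g n)))"
    by (rule null_diagonal[OF ccc wd, of "\<lambda>n k. inf e (b n k)"])
      (auto simp: decseq_inf_INF b)
  have "symdiff (t n (g n)) x \<le> sup (inf e (b n (g n))) (symdiff (s n) x)" for n
  proof -
    have "t n (g n) \<le> e" "s n \<le> e"
      using t(1)[of n] A s unfolding seq_limits_def by blast+
    then have "symdiff (t n (g n)) (s n) \<le> e" by (meson le_sup_iff order_trans symdiff_le)
    then have "symdiff (t n (g n)) (s n) \<le> inf e (b n (g n))" using b(3) by simp
    then show ?thesis using symdiff_triangle[of "t n (g n)" x "s n"]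
      by (meson order_refl order_trans sup_mono)
  qed
  then have "null (\<lambda>n. symdiff (t n (g n)) x)" by (rule null_mono[OF null_sup[OF g x(2)]])
  moreover have "range (\<lambda>n. t n (g n)) \<subseteq> A" using t(1) by blast
  ultimately show "x \<in> seq_limits e A"
    using x(1) unfolding seq_limits_def by blast
qed

definition solid_nbhd :: "'a::{boolean_algebra,complete_lattice} \<Rightarrow> 'a set \<Rightarrow> bool" where
  "solid_nbhd e U \<longleftrightarrow> openin (tau_s e) U \<and> bot \<in> U \<and> (\<forall>x\<in>U. \<forall>y\<le>x. y \<in> U)"

text \<open>\<open>A\<close> collects the elements with a part outside \<open>U\<close>. It is
  upward closed in \<open>{..e}\<close>, and so is the set of limits of its sequences; that set is
  also closed, so its complement is as required.\<close>

lemma ex_solid_nbhd: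
  fixes U :: "'a::{boolean_algebra,complete_lattice} set"
  assumes ccc: "ccc TYPE('a)" and wd: "weakly_distributive e" and U: "openin (tau_s e) U" "bot \<in> U"
  obtains V where "solid_nbhd e V" "V \<subseteq> U"
proof -
  define A where "A = {x. x \<le> e \<and> (\<exists>y\<le>x. y \<notin> U)}"
  define V where "V = {..e} - seq_limits e A"
  have A: "A \<subseteq> {..e}" by (auto simp: A_def)
  have "lim_closed e ({..e} - V)"
  proof -
    have "{..e} - V = seq_limits e A" by (auto simp: V_def seq_limits_def)
    with lim_closed_seq_limits[OF ccc wd A] show ?thesis by simp
  qed
  then have "openin (tau_s e) V"
    by (simp add: openin_tau_s os_closure_fixed_iff) (simp add: V_def)
  moreover have "V \<subseteq> U"
  proof
    fix x assume x: "x \<in> V"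
    show "x \<in> U"
    proof (rule ccontr)
      assume "x \<notin> U"
      then have "x \<in> seq_limits e A"
        using x by (auto simp: seq_limits_def V_def A_def intro!: exI[of _ "\<lambda>n. x"])
      then show False using x by (simp add: V_def)
    qed
  qed
  \<comment> \<open>If members of \<open>A\<close> tended to \<open>bot\<close>, so would their
    parts outside \<open>U\<close>, against openness of \<open>U\<close> at
    \<open>bot\<close>.\<close>
  moreover have "bot \<in> V"
  proof (rule ccontr)
    assume "bot \<notin> V"
    then obtain s where s: "range s \<subseteq> A" "null s" by (auto simp: V_def seq_limits_def)
    have "\<forall>n. \<exists>y. y \<le> s n \<and> s n \<le> e \<and> y \<notin> U" using s(1) by (auto simp: A_def)
    then obtain y where y: "\<And>n. y n \<le> s n" "\<And>n. s n \<le> e" "\<And>n. y n \<notin> U" by metis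
    obtain n where "y n \<in> U"
      by (rule openin_tau_s_seq[OF U(1) _ U(2), of y])
        (use y null_mono[OF s(2)] in \<open>auto intro: order_trans\<close>)
    then show False using y(3) by blast
  qed
  \<comment> \<open>Joining \<open>x\<close> to a sequence in \<open>A\<close> with limit
    \<open>y\<close> gives a sequence in \<open>A\<close> with limit \<open>x\<close>.\<close>
  moreover have "y \<in> V" if x: "x \<in> V" and le: "y \<le> x" for x y
  proof (rule ccontr)
    have xe: "x \<le> e" using x by (simp add: V_def)
    assume "y \<notin> V"
    then obtain s where s: "range s \<subseteq> A" "null (\<lambda>n. symdiff (s n) y)"
      using le xe by (auto simp: V_def seq_limits_def)
    have "range (\<lambda>n. sup (s n) x) \<subseteq> A"
      using s(1) xe unfolding A_def image_subset_iff by (auto intro: le_supI1)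
    moreover have "null (\<lambda>n. symdiff (sup (s n) x) x)"
      by (rule null_mono[OF s(2)]) (metis le symdiff_sup_le sup_absorb2)
    ultimately have "x \<in> seq_limits e A" using xe unfolding seq_limits_def by blast
    then show False using x by (simp add: V_def)
  qed
  ultimately show ?thesis by (intro that[of V]) (auto simp: solid_nbhd_def)
qed

section \<open>Limits superior along sets of indices\<close>

definition limsup_on :: "nat set \<Rightarrow> (nat \<Rightarrow> 'a::{boolean_algebra,complete_lattice}) \<Rightarrow> 'a" where
  "limsup_on I x = (INF N. SUP n\<in>{n\<in>I. N \<le> n}. x n)"

lemma limsup_on_le_tail: "limsup_on I x \<le> (SUP n\<in>{n\<in>I. N \<le> n}. x n)"
  unfolding limsup_on_def by (rule INF_lower) simp

lemma limsup_on_le_SUP: "limsup_on I x \<le> (SUP n\<in>I. x n)"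
  using limsup_on_le_tail[of I x 0] by simp

lemma limsup_on_almost_mono:
  assumes "finite (J - I)"
  shows "limsup_on J x \<le> limsup_on I x"
proof -
  obtain K where K: "\<And>n. n \<in> J - I \<Longrightarrow> n < K"
    using assms finite_nat_set_iff_bounded by auto
  have "limsup_on J x \<le> (SUP n\<in>{n\<in>I. N \<le> n}. x n)" for N
  proof -
    have "{n \<in> J. max N K \<le> n} \<subseteq> {n \<in> I. N \<le> n}" using K by force
    then have "(SUP n\<in>{n \<in> J. max N K \<le> n}. x n) \<le> (SUP n\<in>{n\<in>I. N \<le> n}. x n)"
      by (intro SUP_subset_mono) auto
    with limsup_on_le_tail show ?thesis by (rule order_trans)
  qed
  then show ?thesis unfolding limsup_on_def[of I] by (rule INF_greatest)
qed

text \<open>The excess of the tails over the limit superior decreases to \<open>bot\<close>, and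
  \<open>x (r n)\<close> belongs to the tail from \<open>n\<close> because \<open>r n\<close> is at
  least \<open>n\<close>.\<close>

lemma null_diff_limsup_on:
  assumes "strict_mono r" "range r \<subseteq> I"
  shows "null (\<lambda>n. x (r n) - limsup_on I x)"
proof -
  let ?S = "\<lambda>N. SUP n\<in>{n\<in>I. N \<le> n}. x n"
  let ?l = "limsup_on I x"
  have "decseq (\<lambda>N. ?S N - ?l)"
    by (auto simp: decseq_def diff_eq intro!: le_infI1 SUP_subset_mono)
  moreover have "(INF N. ?S N - ?l) = bot"
  proof -
    have "(INF N. ?S N - ?l) \<le> inf ?l (- ?l)"
    proof (rule le_infI)
      show "(INF N. ?S N - ?l) \<le> ?l"
        unfolding limsup_on_def by (rule INF_mono') (simp add: diff_eq)
      show "(INF N. ?S N - ?l) \<le> - ?l"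
        by (rule INF_lower2[OF UNIV_I]) (simp add: diff_eq)
    qed
    then show ?thesis by (simp add: bot_unique)
  qed
  ultimately have "null (\<lambda>N. ?S N - ?l)" by (rule null_decseq)
  moreover have "x (r n) - ?l \<le> ?S n - ?l" for n
  proof -
    have "x (r n) \<le> ?S n" using assms seq_suble[OF assms(1), of n] by (intro SUP_upper) auto
    then show ?thesis by (simp add: diff_eq le_infI1)
  qed
  ultimately show ?thesis by (rule null_mono)
qed

lemma pseudo_intersection:
  fixes F :: "nat \<Rightarrow> nat set"
  assumes "\<And>n. infinite (\<Inter>i\<le>n. F i)"
  obtains J where "infinite J" "J \<subseteq> F 0" "\<And>i. finite (J - F i)"
proof -
  have "\<exists>r. \<forall>n. r n \<in> (\<Inter>i\<le>n. F i) \<and> r n < r (Suc n)"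
  proof (rule dependent_nat_choice)
    show "\<exists>x. x \<in> (\<Inter>i\<le>0. F i)" using assms[of 0] by (metis ex_in_conv finite.emptyI)
    fix x n show "\<exists>y. y \<in> (\<Inter>i\<le>Suc n. F i) \<and> x < y"
      using assms[of "Suc n"] unfolding infinite_nat_iff_unbounded by blast
  qed
  then obtain r where r: "\<And>n. r n \<in> (\<Inter>i\<le>n. F i)" "\<And>n. r n < r (Suc n)" by blast
  have "strict_mono r" using r(2) by (simp add: strict_mono_Suc_iff)
  then have "infinite (range r)" using strict_mono_imp_inj_on range_inj_infinite by blast
  moreover have "n < i" if "r n \<notin> F i" for n i
    using r(1)[of n] that by (auto simp: not_less[symmetric])
  then have "range r - F i \<subseteq> r ` {..<i}" for i by blast
  then have "finite (range r - F i)" for i by (rule finite_subset) simp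
  moreover have "range r \<subseteq> F 0" using r(1) by auto
  ultimately show ?thesis by (intro that[of "range r"])
qed

text \<open>By ccc a chain of index sets with strictly decreasing limits superior has a countable part
  with the same infimum, so a pseudo-intersection of that part bounds the chain; apply Zorn.\<close>

lemma stable_limsup_on:
  fixes x :: "nat \<Rightarrow> 'a::{boolean_algebra,complete_lattice}"
  assumes ccc: "ccc TYPE('a)" and I: "infinite I"
  shows "\<exists>J\<subseteq>I. infinite J \<and> (\<forall>K\<subseteq>J. infinite K \<longrightarrow> limsup_on K x = limsup_on J x)"
proof -
  let ?A = "{J. J \<subseteq> I \<and> infinite J}"
  let ?l = "\<lambda>J. limsup_on J x"
  \<comment> \<open>Almost inclusion is only a preorder. Demanding a strict drop of the limit
    superior makes the relation antisymmetric, and its maximal elements are the stable sets.\<close>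
  let ?P = "\<lambda>J K. J = K \<or> finite (K - J) \<and> ?l K < ?l J"
  have trans: "finite (L - J)" if "finite (K - J)" "finite (L - K)" for J K L :: "nat set"
    using that by (rule_tac finite_subset[of _ "(K - J) \<union> (L - K)"]) auto
  have "\<exists>m\<in>?A. \<forall>a\<in>?A. ?P m a \<longrightarrow> a = m"
  proof (rule predicate_Zorn)
    show "partial_order_on ?A (relation_of ?P ?A)"
    proof (rule partial_order_on_relation_ofI)
      show "?P J J" for J by simp
      show "?P J L" if "?P J K" "?P K L" for J K L
        using that trans[of K J L] by (auto intro: less_trans)
      show "J = K" if "?P J K" "?P K J" for J K
        using that by (auto dest: less_asym)
    qed
    fix C assume "C \<in> Chains (relation_of ?P ?A)"
    then have chain: "(J, K) \<in> relation_of ?P ?A \<or> (K, J) \<in> relation_of ?P ?A"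
      if "J \<in> C" "K \<in> C" for J K
      using that by (simp add: Chains_def)
    have CA: "J \<subseteq> I \<and> infinite J" if "J \<in> C" for J
      using chain[OF that that] by (simp add: relation_of_def)
    have tot: "?P J K \<or> ?P K J" if "J \<in> C" "K \<in> C" for J K
      using chain[OF that] unfolding relation_of_def by fast
    show "\<exists>u\<in>?A. \<forall>a\<in>C. ?P a u"
    proof (cases "\<exists>J\<in>C. ?l J = Inf (?l ` C)")
      case True
      then obtain J where J: "J \<in> C" "?l J = Inf (?l ` C)" by blast
      \<comment> \<open>Nothing else in the chain can follow \<open>J\<close>, since that would take
        a value below the infimum.\<close>
      have "?P K J" if "K \<in> C" for K
      proof -
        have "?l J \<le> ?l K" unfolding J(2) using that by (rule INF_lower)
        then show ?thesis using tot[OF J(1) that] by auto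
      qed
      then show ?thesis using J(1) CA by blast
    next
      case False
      obtain D0 where "countable D0" "D0 \<subseteq> ?l ` C" and D0: "Inf D0 = Inf (?l ` C)"
        by (rule ccc_countable_Inf[OF ccc])
      then obtain D where D: "countable D" "D \<subseteq> C" "D0 = ?l ` D"
        by (metis countable_subset_image)
      show ?thesis
      proof (cases "C = {}")
        case True
        then show ?thesis using I by blast
      next
        case C: False
        \<comment> \<open>With \<open>D\<close> empty the infimum would be \<open>top\<close>, and
          every member of the nonempty chain would attain it.\<close>
        have "D \<noteq> {}"
        proof
          assume "D = {}"
          then have "Inf (?l ` C) = top" using D0 D(3) by simp
          with C False show False by (metis INF_lower ex_in_conv top_unique)
        qed
        define F where "F = from_nat_into D"
        have F: "range F = D" unfolding F_def using D \<open>D \<noteq> {}\<close> by (intro range_from_nat_into)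
        have FC: "F i \<in> C" for i using F D by blast
        have "\<exists>j. \<forall>i\<le>n. finite (F j - F i)" for n
        proof (induction n)
          case (Suc n)
          then obtain j where j: "\<And>i. i \<le> n \<Longrightarrow> finite (F j - F i)" by blast
          show ?case
          proof (cases "finite (F j - F (Suc n))")
            case True
            then show ?thesis using j by (intro exI[of _ j]) (auto simp: le_Suc_eq)
          next
            case F: False
            then have "finite (F (Suc n) - F j)"
              using tot[OF FC FC, of j "Suc n"] by auto
            then show ?thesis using trans j
              by (intro exI[of _ "Suc n"]) (auto simp: le_Suc_eq)
          qed
        qed (auto intro!: exI[of _ 0])
        have inf: "infinite (\<Inter>i\<le>n. F i)" for n
        proof
          assume fin: "finite (\<Inter>i\<le>n. F i)"
          obtain j where j: "\<And>i. i \<le> n \<Longrightarrow> finite (F j - F i)"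
            using \<open>\<exists>j. \<forall>i\<le>n. finite (F j - F i)\<close> by blast
          have "F j \<subseteq> (\<Inter>i\<le>n. F i) \<union> (\<Union>i\<le>n. F j - F i)" by blast
          moreover have "finite ((\<Inter>i\<le>n. F i) \<union> (\<Union>i\<le>n. F j - F i))" using fin j
            by (intro finite_UnI finite_UN_I) simp_all
          ultimately show False using CA[OF FC] finite_subset by blast
        qed
        obtain J where J: "infinite J" "J \<subseteq> F 0" "\<And>i. finite (J - F i)"
          using pseudo_intersection[of F, OF inf] by blast
        have JD: "?l J \<le> Inf (?l ` C)"
          unfolding D0[symmetric] D(3) F[symmetric]
          by (auto intro!: INF_greatest limsup_on_almost_mono J(3))
        have "?P K J" if K: "K \<in> C" for K
        proof -
          have lt: "Inf (?l ` C) < ?l K"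
            using False K by (metis INF_lower order_le_less)
          \<comment> \<open>Such an \<open>F i\<close> cannot precede \<open>K\<close> in the chain,
            so it is almost contained in \<open>K\<close>.\<close>
          have "\<exists>i. \<not> ?l K \<le> ?l (F i)"
          proof (rule ccontr)
            assume "\<nexists>i. \<not> ?l K \<le> ?l (F i)"
            then have "?l K \<le> Inf (?l ` C)"
              unfolding D0[symmetric] D(3) F[symmetric] by (auto intro!: INF_greatest)
            then show False using lt by simp
          qed
          then obtain i where i: "\<not> ?l K \<le> ?l (F i)" by blast
          then have "finite (F i - K)" using tot[OF K FC, of i] by auto
          then have "finite (J - K)" using trans J(3) by blast
          then show ?thesis using JD lt by auto
        qed
        moreover have "J \<in> ?A" using J CA[OF FC] by blast
        ultimately show ?thesis by blast
      qed
    qed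
  qed
  then obtain J where JA: "J \<in> ?A" and max: "\<forall>K\<in>?A. ?P J K \<longrightarrow> K = J" ..
  from JA have J: "J \<subseteq> I" "infinite J" by simp_all
  have "?l K = ?l J" if K: "K \<subseteq> J" "infinite K" for K
  proof (rule ccontr)
    assume "?l K \<noteq> ?l J"
    moreover have fin: "finite (K - J)" using K(1) by (simp add: Diff_eq_empty_iff[THEN iffD2])
    ultimately have "?l K < ?l J"
      using limsup_on_almost_mono[OF fin] by (simp add: order_less_le)
    then have "K = J" using max K J(1) fin by simp
    then show False using \<open>?l K < ?l J\<close> by simp
  qed
  with J show ?thesis by blast
qed

section \<open>Neighbourhoods of zero\<close>

lemma solid_nbhdD:
  assumes "solid_nbhd e U"
  shows "openin (tau_s e) U" "bot \<in> U" "x \<in> U \<Longrightarrow> y \<le> x \<Longrightarrow> y \<in> U" "x \<in> U \<Longrightarrow> x \<le> e"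
  using assms openin_tau_s_le unfolding solid_nbhd_def by blast+

lemma solid_nbhd_null:
  assumes U: "solid_nbhd e U" and p: "p \<in> U" and s: "\<And>n. s n \<le> e" "null s"
  shows "\<exists>n. sup p (s n) \<in> U"
proof -
  have "null (\<lambda>n. symdiff (sup p (s n)) p)"
    using s(2) by (rule null_mono) (simp add: symdiff_le_iff le_supI1)
  moreover have "sup p (s n) \<le> e" for n using solid_nbhdD(4)[OF U p] s(1) by simp
  ultimately show ?thesis
    using openin_tau_s_seq[OF solid_nbhdD(1)[OF U], of "\<lambda>n. sup p (s n)"] p by metis
qed

text \<open>Joining with a fixed member of \<open>U\<close> is continuous and sends
  \<open>bot\<close> into \<open>U\<close>, so the finitely many preimages of \<open>U\<close> are
  open neighbourhoods of \<open>bot\<close>.\<close>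

lemma solid_nbhd_absorb:
  fixes e :: "'a::{boolean_algebra,complete_lattice}"
  assumes ccc: "ccc TYPE('a)" and wd: "weakly_distributive e"
    and U: "solid_nbhd e U" and a: "finite I" "\<And>i. i \<in> I \<Longrightarrow> a i \<in> U"
  obtains V where "solid_nbhd e V" "V \<subseteq> U" "\<And>t i. t \<in> V \<Longrightarrow> i \<in> I \<Longrightarrow> sup t (a i) \<in> U"
proof -
  have "openin (tau_s e) ({x. x \<le> e \<and> sup x b \<in> U})" if "b \<in> U" for b
    using U that
    by (intro openin_tau_s_vimage[of e]) (auto simp: symdiff_sup_le dest: solid_nbhdD)
  then have "openin (tau_s e) (U \<inter> (\<Inter>i\<in>I. {x. x \<le> e \<and> sup x (a i) \<in> U}))"
    using a U solid_nbhdD(1) by (cases "I = {}") (auto intro!: openin_Int openin_Inter)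
  moreover have "bot \<in> U \<inter> (\<Inter>i\<in>I. {x. x \<le> e \<and> sup x (a i) \<in> U})"
    using a U by (auto dest: solid_nbhdD)
  ultimately obtain V where "solid_nbhd e V" "V \<subseteq> U \<inter> (\<Inter>i\<in>I. {x. x \<le> e \<and> sup x (a i) \<in> U})"
    by (rule ex_solid_nbhd[OF ccc wd])
  then show ?thesis by (intro that[of V]) auto
qed

definition joins :: "'a::boolean_algebra set \<Rightarrow> 'a set" where
  "joins U = {sup p q |p q. p \<in> U \<and> q \<in> U}"

lemma joinsI: "p \<in> U \<Longrightarrow> q \<in> U \<Longrightarrow> sup p q \<in> joins U"
  by (auto simp: joins_def)

lemma joins_solid:
  assumes "\<And>x y. x \<in> U \<Longrightarrow> y \<le> x \<Longrightarrow> y \<in> U" "x \<in> joins U" "y \<le> x"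
  shows "y \<in> joins U"
proof -
  obtain p q where pq: "x = sup p q" "p \<in> U" "q \<in> U" using assms(2) by (auto simp: joins_def)
  have "y = inf y (sup p q)" using assms(3) pq(1) by (simp add: inf_absorb1)
  also have "\<dots> = sup (inf y p) (inf y q)" by (rule inf_sup_distrib1)
  also have "\<dots> \<in> joins U" by (intro joinsI assms(1)[OF pq(2)] assms(1)[OF pq(3)] inf_le2)
  finally show ?thesis .
qed

text \<open>If a triple outside \<open>joins U\<close> exists in every \<open>V\<close>, choose such triples successively so that
  any join with at most one member of each triple stays in \<open>U\<close>. Along a set of indices on which the
  limits superior of the three sequences are stable, distributing the members over three classes of
  indices catches all three limits superior in one such join.\<close>

lemma solid_nbhd_three_joins:
  fixes e :: "'a::{boolean_algebra,complete_lattice}"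
  assumes ccc: "ccc TYPE('a)" and wd: "weakly_distributive e" and U: "solid_nbhd e U"
  shows "\<exists>V. solid_nbhd e V \<and> V \<subseteq> U \<and>
    (\<forall>x\<in>V. \<forall>y\<in>V. \<forall>z\<in>V. sup x (sup y z) \<in> joins U)"
    (is "\<exists>V. ?R V")
proof (rule ccontr)
  assume nt: "\<nexists>V. ?R V"
  have neg: "\<exists>x y z. x \<in> V \<and> y \<in> V \<and> z \<in> V \<and> sup x (sup y z) \<notin> joins U"
    if V: "solid_nbhd e V" "V \<subseteq> U" for V using nt V by blast
  define I :: "nat set" where "I = {0, 1, 2}"
  have triple: "\<exists>a. (\<forall>i\<in>I. a i \<in> V) \<and> sup (a 0) (sup (a 1) (a 2)) \<notin> joins U"
    if V: "solid_nbhd e V" "V \<subseteq> U" for V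
  proof -
    obtain x y z where "x \<in> V" "y \<in> V" "z \<in> V" "sup x (sup y z) \<notin> joins U"
      using neg[OF V] by blast
    then show ?thesis
      by (intro exI[of _ "\<lambda>i. if i = 0 then x else if i = 1 then y else z"]) (simp add: I_def)
  qed
  let ?P = "\<lambda>(n::nat) (V, a :: nat \<Rightarrow> 'a). solid_nbhd e V \<and> V \<subseteq> U \<and> (\<forall>i\<in>I. a i \<in> V) \<and>
    sup (a 0) (sup (a 1) (a 2)) \<notin> joins U"
  \<comment> \<open>Any member of a triple can be joined to an element of the next neighbourhood
    without leaving the present one. Iterated, this keeps joins over finitely many consecutive
    triples, one member from each, in the neighbourhood of the first.\<close>
  let ?Q = "\<lambda>(n::nat) (V, a :: nat \<Rightarrow> 'a) (V', a'). \<forall>t\<in>V'. \<forall>i\<in>I. sup t (a i) \<in> V"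
  have "\<exists>f. \<forall>n. ?P n (f n) \<and> ?Q n (f n) (f (Suc n))"
  proof (rule dependent_nat_choice)
    obtain a where "\<forall>i\<in>I. a i \<in> U" "sup (a 0) (sup (a 1) (a 2)) \<notin> joins U"
      using triple[OF U order_refl] by blast
    then show "\<exists>x. ?P 0 x" using U by (intro exI[of _ "(U, a)"]) simp
    fix x n assume x: "?P n x"
    obtain V a where xV: "x = (V, a)" by (cases x)
    obtain V' where V': "solid_nbhd e V'" "V' \<subseteq> V" "\<And>t i. t \<in> V' \<Longrightarrow> i \<in> I \<Longrightarrow> sup t (a i) \<in> V"
      by (rule solid_nbhd_absorb[OF ccc wd, of V I a]) (use x xV in \<open>auto simp: I_def\<close>)
    then have V'U: "V' \<subseteq> U" using x xV by auto
    obtain a' where "\<forall>i\<in>I. a' i \<in> V'" "sup (a' 0) (sup (a' 1) (a' 2)) \<notin> joins U"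
      using triple[OF V'(1) V'U] by blast
    then show "\<exists>y. ?P (Suc n) y \<and> ?Q n x y"
      using V' V'U xV by (intro exI[of _ "(V', a')"]) simp
  qed
  then obtain f where PQ: "\<forall>n. ?P n (f n) \<and> ?Q n (f n) (f (Suc n))" ..
  have f: "?P n (f n)" "?Q n (f n) (f (Suc n))" for n using PQ[rule_format, of n] by simp_all
  define V where "V n = fst (f n)" for n
  define a where "a n = snd (f n)" for n
  have fn: "f n = (V n, a n)" for n by (simp add: V_def a_def)
  have V: "solid_nbhd e (V n)" "V n \<subseteq> U" and aV: "i \<in> I \<Longrightarrow> a n i \<in> V n"
    and aU: "sup (a n 0) (sup (a n 1) (a n 2)) \<notin> joins U" for n i
    using f(1)[of n] by (simp_all add: fn)
  have step: "sup t (a n i) \<in> V n" if "t \<in> V (Suc n)" "i \<in> I" for t n i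
    using f(2)[of n] that by (simp add: fn)
  have ae: "a n i \<le> e" if "i \<in> I" for n i
    using aV[OF that] V(1) solid_nbhdD(4) by blast

  define st where "st i K \<longleftrightarrow> (\<forall>L\<subseteq>K. infinite L \<longrightarrow>
    limsup_on L (\<lambda>n. a n i) = limsup_on K (\<lambda>n. a n i))" for i K
  have st_sub: "st i L" if "st i K" "L \<subseteq> K" "infinite L" for i K L
    using that unfolding st_def by (metis order_trans)
  have ex_st: "\<exists>L\<subseteq>K. infinite L \<and> st i L" if K: "infinite K" for i K
    using stable_limsup_on[OF ccc K] unfolding st_def by blast
  obtain J0 where J0: "infinite J0" "st 0 J0" using ex_st[OF infinite_UNIV_nat] by blast
  obtain J1 where J1: "J1 \<subseteq> J0" "infinite J1" "st 1 J1" using ex_st[OF J0(1)] by blast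
  obtain J where J: "J \<subseteq> J1" "infinite J" "st 2 J" using ex_st[OF J1(2)] by blast
  have stJ: "st i J" if "i \<in> I" for i
    using that J J1 J0 st_sub unfolding I_def by (metis insertE order_trans empty_iff)
  obtain r :: "nat \<Rightarrow> nat" where r: "strict_mono r" "range r \<subseteq> J"
    using infinite_enumerate[OF J(2)] by blast
  have inj: "inj r" using r(1) by (rule strict_mono_imp_inj_on)

  \<comment> \<open>The three classes are the residues of the position in the enumeration
    \<open>r\<close>. Off the range of \<open>r\<close> the value of \<open>inv r\<close> is
    arbitrary, but its residue still names a member of the triple.\<close>
  define c where "c m = inv r m mod 3" for m
  have cI: "c m \<in> I" for m unfolding c_def I_def by auto
  have cr: "c (r n) = n mod 3" for n unfolding c_def by (simp add: inv_f_f[OF inj])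
  define t where "t n = a n (c n)" for n
  define S where "S n k = (SUP i\<in>{n..<n+k}. t i)" for n k
  have SV: "S n k \<in> V n" for n k
  proof (induction k arbitrary: n)
    case 0
    show ?case using solid_nbhdD(2)[OF V(1)] by (simp add: S_def)
  next
    case (Suc k)
    have "{n..<n + Suc k} = insert n {Suc n..<Suc n + k}" by auto
    then have "S n (Suc k) = sup (S (Suc n) k) (t n)" unfolding S_def by (simp add: sup_commute)
    then show ?case using step[OF Suc cI] by (simp add: t_def)
  qed
  define T where "T = (SUP i. t i)"
  \<comment> \<open>The remainders \<open>T - S 0 k\<close> are null, so one of them lies in
    \<open>U\<close>; it serves as the second factor.\<close>
  have "T \<in> joins U"
  proof -
    have inc: "incseq (S 0)" by (auto simp: incseq_def S_def intro!: SUP_subset_mono)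
    have ST: "(SUP k. S 0 k) = T"
    proof (rule antisym)
      show "(SUP k. S 0 k) \<le> T" by (auto simp: S_def T_def intro!: SUP_least intro: SUP_upper)
      have "t i \<le> (SUP k. S 0 k)" for i
        by (rule SUP_upper2[of "Suc i"]) (auto simp: S_def intro!: SUP_upper)
      then show "T \<le> (SUP k. S 0 k)" by (auto simp: T_def intro: SUP_least)
    qed
    have Te: "T \<le> e" by (auto simp: T_def t_def intro!: SUP_least ae cI)
    have "null (\<lambda>k. T - S 0 k)" using null_SUP_incseq[OF inc] by (simp add: ST)
    moreover have "T - S 0 k \<le> e" for k using Te by (simp add: diff_eq le_infI1)
    ultimately obtain k where k: "sup bot (T - S 0 k) \<in> U"
      using solid_nbhd_null[OF U solid_nbhdD(2)[OF U], of "\<lambda>k. T - S 0 k"] by blast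
    have "S 0 k \<le> T" unfolding ST[symmetric] by (rule SUP_upper) simp
    then have "T = sup (S 0 k) (T - S 0 k)"
      by (simp add: diff_eq sup_inf_distrib1 sup_absorb2)
    also have "\<dots> \<in> joins U" using SV[of 0 k] V(2)[of 0] k by (intro joinsI) auto
    finally show ?thesis .
  qed
  define l where "l i = limsup_on J (\<lambda>n. a n i)" for i
  \<comment> \<open>On the class \<open>L\<close> the choice \<open>t\<close> takes member
    \<open>i\<close>, and stability equates the limits superior along \<open>L\<close> and along
    \<open>J\<close>.\<close>
  have lT: "l i \<le> T" if i: "i \<in> I" for i
  proof -
    define L where "L = r ` {n. n mod 3 = i}"
    have "infinite {n::nat. n mod 3 = i}"
      unfolding infinite_nat_iff_unbounded
    proof
      fix m
      have "m < 3 * Suc m + i" "(3 * Suc m + i) mod 3 = i" using i by (auto simp: I_def)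
      then show "\<exists>n>m. n \<in> {n. n mod 3 = i}" by blast
    qed
    then have "infinite L" unfolding L_def
      using finite_imageD[OF _ inj_on_subset[OF inj subset_UNIV]] by blast
    moreover have "L \<subseteq> J" using r(2) by (auto simp: L_def)
    ultimately have "l i = limsup_on L (\<lambda>n. a n i)"
      using stJ[OF i] by (simp add: st_def l_def)
    also have "\<dots> \<le> (SUP n\<in>L. a n i)" by (rule limsup_on_le_SUP)
    also have "\<dots> \<le> T" unfolding T_def
      by (intro SUP_subset_mono) (auto simp: L_def t_def cr)
    finally show ?thesis .
  qed
  have "sup (l 0) (sup (l 1) (l 2)) \<le> T" using lT by (simp add: I_def)
  with \<open>T \<in> joins U\<close> have "sup (l 0) (sup (l 1) (l 2)) \<in> joins U"
    by (rule joins_solid[rotated]) (rule solid_nbhdD(3)[OF U])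
  then obtain p q where pq: "sup (l 0) (sup (l 1) (l 2)) = sup p q" "p \<in> U" "q \<in> U"
    by (auto simp: joins_def)
  \<comment> \<open>Along \<open>r\<close> the excess over the limits superior is null. Once
    \<open>p\<close> absorbs it within \<open>U\<close>, a whole triple lies in
    \<open>joins U\<close>.\<close>
  define d where "d n i = a (r n) i - l i" for n i
  have dnull: "null (\<lambda>n. d n i)" for i
    unfolding d_def l_def by (rule null_diff_limsup_on[OF r])
  have de: "d n i \<le> e" if "i \<in> I" for n i
    using ae[OF that] by (simp add: d_def diff_eq le_infI1)
  have "null (\<lambda>n. sup (d n 0) (sup (d n 1) (d n 2)))"
    by (intro null_sup dnull)
  moreover have "sup (d n 0) (sup (d n 1) (d n 2)) \<le> e" for n
    using de by (simp add: I_def)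
  ultimately obtain n where n: "sup p (sup (d n 0) (sup (d n 1) (d n 2))) \<in> U"
    using solid_nbhd_null[OF U pq(2), of "\<lambda>n. sup (d n 0) (sup (d n 1) (d n 2))"] by blast
  have "a (r n) i \<le> sup (l i) (d n i)" for i
    by (simp add: d_def flip: diff_le_iff_le_sup)
  then have "sup (a (r n) 0) (sup (a (r n) 1) (a (r n) 2)) \<le>
      sup (sup (l 0) (d n 0)) (sup (sup (l 1) (d n 1)) (sup (l 2) (d n 2)))"
    by (intro sup_mono)
  also have "\<dots> = sup (sup (l 0) (sup (l 1) (l 2))) (sup (d n 0) (sup (d n 1) (d n 2)))"
    by (simp only: ac_simps)
  also have "\<dots> = sup (sup p (sup (d n 0) (sup (d n 1) (d n 2)))) q"
    unfolding pq(1) by (simp only: ac_simps)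
  finally have "sup (a (r n) 0) (sup (a (r n) 1) (a (r n) 2)) \<in> joins U"
    by (rule joins_solid[rotated 2]) (use solid_nbhdD(3)[OF U] joinsI[OF n pq(3)] in blast)+
  then show False using aU by blast
qed

section \<open>The submeasure of a chain of neighbourhoods\<close>

text \<open>Three passages from three joins to two: six members of \<open>V3\<close>, grouped as 3 +
  3, become four of \<open>V2\<close>; three of these become two of \<open>V1\<close>, and the
  fourth completes a triple in \<open>V1\<close>.\<close>

lemma solid_nbhd_joins_three_joins:
  fixes e :: "'a::{boolean_algebra,complete_lattice}"
  assumes ccc: "ccc TYPE('a)" and wd: "weakly_distributive e" and U: "solid_nbhd e U"
  shows "\<exists>V. solid_nbhd e V \<and>
    (\<forall>x\<in>joins V. \<forall>y\<in>joins V. \<forall>z\<in>joins V. sup x (sup y z) \<in> joins U)"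
proof -
  obtain V1 where V1: "solid_nbhd e V1" "V1 \<subseteq> U"
    "\<And>x y z. x \<in> V1 \<Longrightarrow> y \<in> V1 \<Longrightarrow> z \<in> V1 \<Longrightarrow> sup x (sup y z) \<in> joins U"
    using solid_nbhd_three_joins[OF ccc wd U] by blast
  obtain V2 where V2: "solid_nbhd e V2" "V2 \<subseteq> V1"
    "\<And>x y z. x \<in> V2 \<Longrightarrow> y \<in> V2 \<Longrightarrow> z \<in> V2 \<Longrightarrow> sup x (sup y z) \<in> joins V1"
    using solid_nbhd_three_joins[OF ccc wd V1(1)] by blast
  obtain V3 where V3: "solid_nbhd e V3" "V3 \<subseteq> V2"
    "\<And>x y z. x \<in> V3 \<Longrightarrow> y \<in> V3 \<Longrightarrow> z \<in> V3 \<Longrightarrow> sup x (sup y z) \<in> joins V2"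
    using solid_nbhd_three_joins[OF ccc wd V2(1)] by blast
  have "sup x (sup y z) \<in> joins U"
    if xyz: "x \<in> joins V3" "y \<in> joins V3" "z \<in> joins V3" for x y z
  proof -
    obtain x1 x2 y1 y2 z1 z2 where
      eq: "x = sup x1 x2" "y = sup y1 y2" "z = sup z1 z2"
      and mem: "x1 \<in> V3" "x2 \<in> V3" "y1 \<in> V3" "y2 \<in> V3" "z1 \<in> V3" "z2 \<in> V3"
      using xyz unfolding joins_def by blast
    obtain p1 p2 where p: "sup x1 (sup x2 y1) = sup p1 p2" "p1 \<in> V2" "p2 \<in> V2"
      using V3(3)[OF mem(1-3)] unfolding joins_def by blast
    obtain q1 q2 where q: "sup y2 (sup z1 z2) = sup q1 q2" "q1 \<in> V2" "q2 \<in> V2"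
      using V3(3)[OF mem(4-6)] unfolding joins_def by blast
    obtain r1 r2 where r: "sup p1 (sup p2 q1) = sup r1 r2" "r1 \<in> V1" "r2 \<in> V1"
      using V2(3)[OF p(2,3) q(2)] unfolding joins_def by blast
    have "sup x (sup y z) = sup (sup x1 (sup x2 y1)) (sup y2 (sup z1 z2))"
      by (simp only: eq ac_simps)
    also have "\<dots> = sup (sup p1 (sup p2 q1)) q2" unfolding p(1) q(1) by (simp only: ac_simps)
    also have "\<dots> = sup r1 (sup r2 q2)" unfolding r(1) by (simp only: ac_simps)
    also have "\<dots> \<in> joins U" using V1(3) r q(3) V2(2) by blast
    finally show ?thesis .
  qed
  with V3(1) show ?thesis by blast
qed

section \<open>The Birkhoff-Kakutani construction for a chain of downward closed sets\<close>

definition weight :: "(nat \<times> 'a) list \<Rightarrow> real" where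
  "weight ps = (\<Sum>p\<leftarrow>ps. (1 / 2) ^ fst p)"

lemma weight_simps [simp]:
  "weight [] = 0" "weight (p # ps) = (1 / 2) ^ fst p + weight ps"
  "weight (ps @ qs) = weight ps + weight qs"
  by (simp_all add: weight_def)

lemma weight_nonneg: "0 \<le> weight ps"
  by (induction ps) auto

text \<open>The cut is made at the first entry with which the running weight exceeds
  \<open>t\<close>.\<close>

lemma weight_split:
  assumes "0 \<le> t" "t < weight ps"
  shows "\<exists>xs p ys. ps = xs @ p # ys \<and> weight xs \<le> t \<and> t < weight xs + (1 / 2) ^ fst p"
  using assms
proof (induction ps arbitrary: t)
  case (Cons q ps)
  show ?case
  proof (cases "t < (1 / 2) ^ fst q")
    case True
    then show ?thesis using Cons.prems by (intro exI[of _ "[]"]) auto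
  next
    case False
    then obtain xs p ys where "ps = xs @ p # ys" "weight xs \<le> t - (1 / 2) ^ fst q"
      "t - (1 / 2) ^ fst q < weight xs + (1 / 2) ^ fst p"
      using Cons.IH[of "t - (1 / 2) ^ fst q"] Cons.prems by auto
    then show ?thesis
      by (intro exI[of _ "q # xs"] exI[of _ p] exI[of _ ys]) auto
  qed
qed simp

text \<open>\<open>F_0\<close> provides a cover for every element below \<open>e\<close>,
  \<open>join_F\<close> absorbs the two halves of a list and the entry between them, and
  \<open>null_F\<close> is the source of continuity.\<close>

locale join_chain =
  fixes e :: "'a::{boolean_algebra,complete_lattice}" and F :: "nat \<Rightarrow> 'a set"
  assumes F_0: "F 0 = {..e}"
    and bot_F: "bot \<in> F n"
    and solid_F: "x \<in> F n \<Longrightarrow> y \<le> x \<Longrightarrow> y \<in> F n"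
    and join_F: "x \<in> F (Suc n) \<Longrightarrow> y \<in> F (Suc n) \<Longrightarrow> z \<in> F (Suc n) \<Longrightarrow> sup x (sup y z) \<in> F n"
    and null_F: "(\<And>k. s k \<le> e) \<Longrightarrow> null s \<Longrightarrow> \<exists>k. s k \<in> F n"
begin

text \<open>An element may lie in several \<open>F n\<close>, so each entry records the level at
  which it is priced.\<close>

definition covers :: "'a \<Rightarrow> (nat \<times> 'a) list set" where
  "covers x = {ps. (\<forall>(n, y)\<in>set ps. y \<in> F n) \<and> x \<le> Sup (snd ` set ps)}"

definition chain_submeasure :: "'a \<Rightarrow> real" where
  "chain_submeasure x = (INF ps\<in>covers x. weight ps)"

lemma decseq_F: "m \<le> n \<Longrightarrow> F n \<subseteq> F m"
proof (rule lift_Suc_antimono_le[of F])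
  show "F (Suc n) \<subseteq> F n" for n
    using join_F[OF _ bot_F bot_F] by auto
qed

text \<open>Cut the list at half of its weight: the two parts and the element in between lie one step
  further down the chain.\<close>

lemma Sup_in_F:
  assumes "\<forall>(n, y)\<in>set ps. y \<in> F n" "weight ps < (1 / 2) ^ n"
  shows "Sup (snd ` set ps) \<in> F n"
  using assms
proof (induction "length ps" arbitrary: ps n rule: less_induct)
  case less
  show ?case
  proof (cases "ps = []")
    case False
    then obtain p ps' where "ps = p # ps'" by (cases ps) auto
    then have pos: "0 < weight ps" using weight_nonneg[of ps'] by (simp add: add_pos_nonneg)
    then obtain xs m x ys where split: "ps = xs @ (m, x) # ys" "weight xs \<le> weight ps / 2"
      "weight ps / 2 < weight xs + (1 / 2) ^ m"
      using weight_split[of "weight ps / 2" ps] by auto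
    \<comment> \<open>Both outer parts are shorter than \<open>ps\<close> and weigh at most half of
      it, hence less than \<open>(1 / 2) ^ Suc n\<close>.\<close>
    have "Sup (snd ` set xs) \<in> F (Suc n)"
      using less.prems split by (intro less.hyps) auto
    moreover have "Sup (snd ` set ys) \<in> F (Suc n)"
      using less.prems split by (intro less.hyps) auto
    \<comment> \<open>A single entry weighs less than \<open>(1 / 2) ^ n\<close>, so its level
      exceeds \<open>n\<close>.\<close>
    moreover have "x \<in> F (Suc n)"
    proof -
      have "(1 / 2) ^ m \<le> weight ps"
        using split(1) weight_nonneg[of xs] weight_nonneg[of ys] by simp
      with less.prems(2) have lt: "(1 / 2) ^ m < ((1 / 2) ^ n :: real)" by linarith
      have "Suc n \<le> m"
      proof (rule ccontr)
        assume "\<not> Suc n \<le> m"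
        then have "(1 / 2) ^ n \<le> ((1 / 2) ^ m :: real)" by (intro power_decreasing) auto
        with lt show False by linarith
      qed
      moreover have "x \<in> F m" using less.prems(1) split(1) by auto
      ultimately show ?thesis using decseq_F by blast
    qed
    ultimately have "sup (Sup (snd ` set xs)) (sup x (Sup (snd ` set ys))) \<in> F n"
      by (intro join_F)
    then show ?thesis by (simp add: split(1) image_Un Sup_union_distrib sup_left_commute)
  qed (simp add: bot_F)
qed

lemma covers_nonempty: "x \<le> e \<Longrightarrow> [(0, x)] \<in> covers x"
  by (simp add: covers_def F_0)

lemma bdd_below_weight: "bdd_below (weight ` X)"
  by (intro bdd_belowI[of _ 0]) (auto simp: weight_nonneg)

lemma chain_submeasure_le: "ps \<in> covers x \<Longrightarrow> chain_submeasure x \<le> weight ps"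
  unfolding chain_submeasure_def by (intro cINF_lower bdd_below_weight)

lemma chain_submeasure_nonneg: "x \<le> e \<Longrightarrow> 0 \<le> chain_submeasure x"
  unfolding chain_submeasure_def using covers_nonempty by (intro cINF_greatest) (auto simp: weight_nonneg)

lemma chain_submeasure_mono:
  assumes "y \<le> e" "x \<le> y"
  shows "chain_submeasure x \<le> chain_submeasure y"
  unfolding chain_submeasure_def
proof (rule cINF_superset_mono)
  show "covers y \<noteq> {}" using covers_nonempty assms by blast
  show "covers y \<subseteq> covers x" unfolding covers_def using assms(2) by auto
qed (auto simp: bdd_below_weight)

lemma chain_submeasure_lessE:
  assumes "x \<le> e" "chain_submeasure x < r"
  obtains ps where "ps \<in> covers x" "weight ps < r"
proof -
  have "weight ` covers x \<noteq> {}" using covers_nonempty[OF assms(1)] by blast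
  then show ?thesis
    using assms(2) that cINF_less_iff[OF _ bdd_below_weight] unfolding chain_submeasure_def by blast
qed

lemma chain_submeasure_sup:
  assumes "x \<le> e" "y \<le> e"
  shows "chain_submeasure (sup x y) \<le> chain_submeasure x + chain_submeasure y"
proof (rule field_le_epsilon)
  fix \<epsilon> :: real assume "0 < \<epsilon>"
  then obtain ps qs where ps: "ps \<in> covers x" "weight ps < chain_submeasure x + \<epsilon> / 2"
    and qs: "qs \<in> covers y" "weight qs < chain_submeasure y + \<epsilon> / 2"
    using chain_submeasure_lessE assms by (metis half_gt_zero less_add_same_cancel1)
  have "ps @ qs \<in> covers (sup x y)"
    using ps(1) qs(1) by (auto simp: covers_def image_Un Sup_union_distrib le_supI1 le_supI2)
  from chain_submeasure_le[OF this] ps(2) qs(2)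
  show "chain_submeasure (sup x y) \<le> chain_submeasure x + chain_submeasure y + \<epsilon>" by simp
qed

lemma chain_submeasure_F: "x \<in> F n \<Longrightarrow> chain_submeasure x \<le> (1 / 2) ^ n"
  using chain_submeasure_le[of "[(n, x)]" x] by (simp add: covers_def)

text \<open>This bounds the submeasure from below, by \<open>(1 / 2) ^ n\<close> outside
  \<open>F n\<close>, and so keeps it from vanishing.\<close>

lemma F_chain_submeasure:
  assumes "x \<le> e" "chain_submeasure x < (1 / 2) ^ n"
  shows "x \<in> F n"
proof -
  obtain ps where "ps \<in> covers x" "weight ps < (1 / 2) ^ n"
    using assms by (rule chain_submeasure_lessE)
  then show ?thesis using Sup_in_F solid_F unfolding covers_def by blast
qed

lemma maharam_chain_submeasure: "maharam_submeasure_on e chain_submeasure"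
  unfolding maharam_submeasure_on_def submeasure_on_def
proof (intro conjI allI impI)
  show "chain_submeasure bot = 0"
    using chain_submeasure_le[of "[]" bot] chain_submeasure_nonneg[of bot] by (simp add: covers_def)
  fix a :: "nat \<Rightarrow> 'a"
  assume a: "range a \<subseteq> {..e} \<and> decseq a \<and> (INF n. a n) = bot"
  then have ae: "a n \<le> e" for n by auto
  show "(\<lambda>n. chain_submeasure (a n)) \<longlonglongrightarrow> 0"
  proof (rule LIMSEQ_I)
    fix r :: real assume "0 < r"
    then obtain n where n: "(1 / 2) ^ n < r"
      using real_arch_pow_inv[of r "1 / 2"] by auto
    have "null a" using a by (intro null_decseq) auto
    then obtain k where k: "a k \<in> F n" using null_F[of a n, OF ae] by blast
    have "norm (chain_submeasure (a j) - 0) < r" if "k \<le> j" for j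
    proof -
      have "a j \<in> F n" using solid_F[OF k] decseqD[of a, OF _ that] a by blast
      then have "chain_submeasure (a j) < r" using chain_submeasure_F n by (meson order_le_less_trans)
      then show ?thesis using chain_submeasure_nonneg[OF ae, of j] by simp
    qed
    then show "\<exists>k. \<forall>j\<ge>k. norm (chain_submeasure (a j) - 0) < r" by blast
  qed
qed (auto intro: chain_submeasure_nonneg chain_submeasure_mono chain_submeasure_sup)

end

lemma ex_maharam_submeasure:
  fixes e :: "'a::{boolean_algebra,complete_lattice}"
  assumes ccc: "ccc TYPE('a)" and wd: "weakly_distributive e" and U: "solid_nbhd e U"
    and a: "a \<le> e" "a \<notin> joins U"
  obtains \<mu> where "maharam_submeasure_on e \<mu>" "\<mu> a \<noteq> 0"
proof -
  let ?Q = "\<lambda>V V'. \<forall>x\<in>joins V'. \<forall>y\<in>joins V'. \<forall>z\<in>joins V'. sup x (sup y z) \<in> joins V"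
  have "\<exists>V. \<forall>n. (solid_nbhd e (V n) \<and> (n = 0 \<longrightarrow> V n = U)) \<and> ?Q (V n) (V (Suc n))"
    by (rule dependent_nat_choice) (use U solid_nbhd_joins_three_joins[OF ccc wd] in auto)
  then obtain V where PQ: "\<forall>n. (solid_nbhd e (V n) \<and> (n = 0 \<longrightarrow> V n = U)) \<and> ?Q (V n) (V (Suc n))" ..
  have V: "solid_nbhd e (V n)" and V0: "V 0 = U"
    and VQ: "\<And>x y z. x \<in> joins (V (Suc n)) \<Longrightarrow> y \<in> joins (V (Suc n)) \<Longrightarrow> z \<in> joins (V (Suc n)) \<Longrightarrow>
      sup x (sup y z) \<in> joins (V n)" for n
    using PQ by auto
  \<comment> \<open>The shift makes room for \<open>{..e}\<close> at level 0. As \<open>a\<close> is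
    outside level 1, its value is at least \<open>1 / 2\<close>.\<close>
  define F where "F n = (case n of 0 \<Rightarrow> {..e} | Suc m \<Rightarrow> joins (V m))" for n
  have F_simps: "F 0 = {..e}" "F (Suc n) = joins (V n)" for n by (simp_all add: F_def)
  have V_joins: "V n \<subseteq> joins (V n)" for n
    using joinsI[OF _ solid_nbhdD(2)[OF V]] by fastforce
  have joins_e: "x \<le> e" if "x \<in> joins (V n)" for x n
    using that solid_nbhdD(4)[OF V] by (auto simp: joins_def)
  interpret join_chain e F
  proof
    show "bot \<in> F n" for n
      using solid_nbhdD(2)[OF V] V_joins by (cases n) (auto simp: F_simps)
    show "y \<in> F n" if "x \<in> F n" "y \<le> x" for x y n
      using that by (cases n) (auto simp: F_simps intro: joins_solid solid_nbhdD(3)[OF V])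
    show "sup x (sup y z) \<in> F n" if "x \<in> F (Suc n)" "y \<in> F (Suc n)" "z \<in> F (Suc n)" for x y z n
      using that VQ joins_e by (cases n) (auto simp: F_simps)
    show "\<exists>k. s k \<in> F n" if s: "\<And>k. s k \<le> e" "null s" for s n
    proof (cases n)
      case (Suc m)
      obtain k where "sup bot (s k) \<in> V m"
        using solid_nbhd_null[OF V solid_nbhdD(2)[OF V], of s] s by blast
      then show ?thesis using V_joins[of m] Suc by (auto simp: F_simps)
    qed (use s in \<open>auto simp: F_simps\<close>)
  qed (simp add: F_simps)
  have "a \<notin> F 1" using a(2) by (simp add: F_simps V0)
  then have "chain_submeasure a \<noteq> 0" using F_chain_submeasure[OF a(1), of 1] by auto
  with maharam_chain_submeasure show ?thesis by (rule that)
qed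

section \<open>Strictly positive Maharam submeasures\<close>

definition carries_maharam :: "'a::{boolean_algebra,complete_lattice} \<Rightarrow> bool" where
  "carries_maharam m \<longleftrightarrow> (\<exists>\<mu>. maharam_submeasure_on m \<mu> \<and> strictly_positive_on m \<mu>)"

lemma maharam_submeasure_onD:
  assumes "maharam_submeasure_on m \<mu>"
  shows "x \<le> m \<Longrightarrow> 0 \<le> \<mu> x" "\<mu> bot = 0" "y \<le> m \<Longrightarrow> x \<le> y \<Longrightarrow> \<mu> x \<le> \<mu> y"
    "x \<le> m \<Longrightarrow> y \<le> m \<Longrightarrow> \<mu> (sup x y) \<le> \<mu> x + \<mu> y"
  using assms unfolding maharam_submeasure_on_def submeasure_on_def by blast+

lemma maharam_submeasure_on_null:
  assumes \<mu>: "maharam_submeasure_on m \<mu>" and s: "\<And>n. s n \<le> m" "null s"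
  shows "(\<lambda>n. \<mu> (s n)) \<longlonglongrightarrow> 0"
proof -
  have "conv_zero m s" using s by (auto simp: conv_zero_iff)
  then obtain b where b: "range b \<subseteq> {..m}" "decseq b" "(INF n. b n) = bot" "\<And>n. s n \<le> b n"
    unfolding conv_zero_def by blast
  have "(\<lambda>n. \<mu> (b n)) \<longlonglongrightarrow> 0" using \<mu> b(1-3) unfolding maharam_submeasure_on_def by blast
  moreover have "\<mu> (s n) \<le> \<mu> (b n)" for n
    using b(1,4) by (intro maharam_submeasure_onD(3)[OF \<mu>]) auto
  ultimately show ?thesis
    using maharam_submeasure_onD(1)[OF \<mu> s(1)]
    by (intro tendsto_sandwich[OF _ _ tendsto_const, of 0 "\<lambda>n. \<mu> (s n)" _ "\<lambda>n. \<mu> (b n)"]) auto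
qed

lemma carries_maharam_le:
  assumes "carries_maharam m" "x \<le> m"
  shows "carries_maharam x"
proof -
  obtain \<mu> where \<mu>: "maharam_submeasure_on m \<mu>" "strictly_positive_on m \<mu>"
    using assms(1) unfolding carries_maharam_def by blast
  have le: "y \<le> m" if "y \<le> x" for y using that assms(2) by (rule order_trans)
  then have "{..x} \<subseteq> {..m}" by auto
  then have "maharam_submeasure_on x \<mu>"
    using \<mu>(1) le unfolding maharam_submeasure_on_def submeasure_on_def by (meson order_trans)
  moreover have "strictly_positive_on x \<mu>" using \<mu>(2) le unfolding strictly_positive_on_def by blast
  ultimately show ?thesis unfolding carries_maharam_def by blast
qed

lemma carries_maharam_bot: "carries_maharam bot"
  unfolding carries_maharam_def
  by (rule exI[of _ "\<lambda>_. 0"])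
    (auto simp: maharam_submeasure_on_def submeasure_on_def strictly_positive_on_def bot_unique)

text \<open>Truncation at 1 and a supremum both preserve subadditivity. The factors
  \<open>(1 / 2) ^ n\<close> make all but finitely many of the submeasures uniformly small, which
  reduces continuity to finitely many of them.\<close>

lemma carries_maharam_SUP:
  fixes a :: "nat \<Rightarrow> 'a::{boolean_algebra,complete_lattice}"
  assumes "\<And>n. carries_maharam (a n)"
  shows "carries_maharam (SUP n. a n)"
proof -
  let ?m = "SUP n. a n"
  obtain \<mu> where \<mu>: "\<And>n. maharam_submeasure_on (a n) (\<mu> n)"
    and pos: "\<And>n. strictly_positive_on (a n) (\<mu> n)"
    using assms unfolding carries_maharam_def by metis
  note \<mu>D = maharam_submeasure_onD[OF \<mu>]
  define \<nu> where "\<nu> n x = (1 / 2) ^ n * min 1 (\<mu> n (inf x (a n)))" for n x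
  define \<rho> where "\<rho> x = (SUP n. \<nu> n x)" for x
  have \<mu>0: "0 \<le> \<mu> n (inf x (a n))" for n x by (rule \<mu>D(1)) simp
  have \<nu>0: "0 \<le> \<nu> n x" for n x by (simp add: \<nu>_def \<mu>0)
  have \<nu>p: "\<nu> n x \<le> (1 / 2) ^ n" for n x by (simp add: \<nu>_def mult_left_le)
  have \<nu>1: "\<nu> n x \<le> 1" for n x using \<nu>p by (rule order_trans) (simp add: power_le_one)
  have bdd: "bdd_above (range (\<lambda>n. \<nu> n x))" for x by (intro bdd_aboveI[of _ 1]) (auto simp: \<nu>1)
  have \<nu>\<rho>: "\<nu> n x \<le> \<rho> x" for n x unfolding \<rho>_def by (rule cSUP_upper[OF _ bdd]) simp
  have \<rho>_least: "\<rho> x \<le> r" if "\<And>n. \<nu> n x \<le> r" for x r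
    unfolding \<rho>_def using that by (intro cSUP_least) auto
  have \<rho>0: "0 \<le> \<rho> x" for x using \<nu>0 \<nu>\<rho>[of 0 x] by (rule order_trans)
  have \<nu>_mono: "\<nu> n x \<le> \<nu> n y" if "x \<le> y" for n x y
  proof -
    have "\<mu> n (inf x (a n)) \<le> \<mu> n (inf y (a n))" by (rule \<mu>D(3)) (auto simp: that le_infI1)
    then show ?thesis unfolding \<nu>_def by (intro mult_left_mono min.mono) auto
  qed
  have \<nu>_sup: "\<nu> n (sup x y) \<le> \<nu> n x + \<nu> n y" for n x y
  proof -
    have "\<mu> n (inf (sup x y) (a n)) \<le> \<mu> n (inf x (a n)) + \<mu> n (inf y (a n))"
      unfolding inf_sup_distrib2 by (rule \<mu>D(4)) auto
    then have "min 1 (\<mu> n (inf (sup x y) (a n))) \<le> min 1 (\<mu> n (inf x (a n))) + min 1 (\<mu> n (inf y (a n)))"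
      using \<mu>0[of n x] \<mu>0[of n y] by linarith
    then show ?thesis unfolding \<nu>_def distrib_left[symmetric] by (rule mult_left_mono) simp
  qed
  have "submeasure_on ?m \<rho>" unfolding submeasure_on_def
  proof (intro conjI allI impI)
    show "\<rho> bot = 0" using \<rho>0[of bot] by (intro antisym \<rho>_least) (auto simp: \<nu>_def \<mu>D(2))
    show "\<rho> x \<le> \<rho> y" if "x \<le> y" for x y
      using \<nu>_mono[OF that] \<nu>\<rho> by (intro \<rho>_least) (rule order_trans)
    show "\<rho> (sup x y) \<le> \<rho> x + \<rho> y" for x y
      by (intro \<rho>_least order_trans[OF \<nu>_sup] add_mono \<nu>\<rho>)
  qed (rule \<rho>0)
  moreover have "(\<lambda>k. \<rho> (b k)) \<longlonglongrightarrow> 0"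
    if b: "decseq b" "(INF k. b k) = bot" for b :: "nat \<Rightarrow> 'a"
  proof (rule LIMSEQ_I)
    fix r :: real assume "0 < r"
    then obtain N where N: "(1 / 2) ^ N < r / 2" using real_arch_pow_inv[of "r / 2" "1 / 2"] by auto
    have "\<forall>\<^sub>F k in sequentially. \<nu> n (b k) < r / 2" for n
    proof -
      have "null (\<lambda>k. inf (b k) (a n))" by (rule null_mono[OF null_decseq[OF b]]) simp
      then have "(\<lambda>k. \<mu> n (inf (b k) (a n))) \<longlonglongrightarrow> 0"
        by (intro maharam_submeasure_on_null[OF \<mu>]) auto
      then have "\<forall>\<^sub>F k in sequentially. \<mu> n (inf (b k) (a n)) < r / 2"
        by (rule order_tendstoD) (use \<open>0 < r\<close> in simp)
      then show ?thesis
      proof (rule eventually_mono)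
        fix k assume "\<mu> n (inf (b k) (a n)) < r / 2"
        moreover have "\<nu> n (b k) \<le> min 1 (\<mu> n (inf (b k) (a n)))"
          unfolding \<nu>_def using \<mu>0 by (intro mult_left_le_one_le) (auto simp: power_le_one)
        ultimately show "\<nu> n (b k) < r / 2" by linarith
      qed
    qed
    then have "\<forall>\<^sub>F k in sequentially. \<forall>n\<in>{..<N}. \<nu> n (b k) < r / 2"
      by (intro eventually_ball_finite) auto
    then obtain K where K: "\<And>k n. k \<ge> K \<Longrightarrow> n < N \<Longrightarrow> \<nu> n (b k) < r / 2"
      unfolding eventually_sequentially by blast
    have "norm (\<rho> (b k) - 0) < r" if "k \<ge> K" for k
    proof -
      have "\<nu> n (b k) \<le> r / 2" for n
      proof (cases "n < N")
        case False
        then have "(1 / 2) ^ n \<le> ((1 / 2) ^ N :: real)" by (intro power_decreasing) auto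
        then show ?thesis using \<nu>p[of n "b k"] N by linarith
      qed (use K that in \<open>auto intro: less_imp_le\<close>)
      then have "\<rho> (b k) \<le> r / 2" by (rule \<rho>_least)
      then show ?thesis using \<rho>0[of "b k"] \<open>0 < r\<close> by simp
    qed
    then show "\<exists>K. \<forall>k\<ge>K. norm (\<rho> (b k) - 0) < r" by blast
  qed
  moreover have "strictly_positive_on ?m \<rho>" unfolding strictly_positive_on_def
  proof (intro allI impI)
    fix x assume x: "x \<le> ?m" "\<rho> x = 0"
    have "inf x (a n) = bot" for n
    proof -
      have "\<nu> n x = 0" using \<nu>\<rho>[of n x] \<nu>0[of n x] x(2) by simp
      then have "\<mu> n (inf x (a n)) = 0" by (simp add: \<nu>_def min_def split: if_splits)
      then show ?thesis using pos[of n] by (simp add: strictly_positive_on_def)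
    qed
    then have "inf x ?m = bot" by (simp add: inf_SUP_distrib)
    then show "x = bot" using x(1) by (simp add: inf_absorb1)
  qed
  ultimately show ?thesis unfolding carries_maharam_def maharam_submeasure_on_def by blast
qed

lemma carries_maharam_Sup:
  assumes "countable A" "\<And>a. a \<in> A \<Longrightarrow> carries_maharam a"
  shows "carries_maharam (Sup A)"
proof (cases "A = {}")
  case False
  then have "Sup A = (SUP n. from_nat_into A n)" using assms(1) by simp
  moreover have "carries_maharam (from_nat_into A n)" for n
    using False by (intro assms(2) from_nat_into)
  ultimately show ?thesis by (simp only: carries_maharam_SUP)
qed (simp add: carries_maharam_bot)

text \<open>Finite joins have value 0 by subadditivity. The remainders \<open>Sup A - s n\<close>
  are null, so continuity carries this over to the countable join.\<close>

lemma maharam_null_Sup: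
  assumes \<mu>: "maharam_submeasure_on e \<mu>" and A: "countable A" "\<And>x. x \<in> A \<Longrightarrow> x \<le> e \<and> \<mu> x = 0"
  shows "\<mu> (Sup A) = 0"
proof (cases "A = {}")
  case False
  define f where "f = from_nat_into A"
  have f: "f n \<le> e" "\<mu> (f n) = 0" for n
    using A(2)[OF from_nat_into[OF False, of n]] by (auto simp: f_def)
  define s where "s n = (SUP i\<in>{..n}. f i)" for n
  have s_Suc: "s (Suc n) = sup (f (Suc n)) (s n)" for n by (simp add: s_def atMost_Suc)
  have se: "s n \<le> e" for n by (auto simp: s_def intro: SUP_least f)
  have s0: "\<mu> (s n) = 0" for n
  proof (induction n)
    case (Suc n)
    have "\<mu> (s (Suc n)) \<le> \<mu> (f (Suc n)) + \<mu> (s n)"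
      unfolding s_Suc by (intro maharam_submeasure_onD(4)[OF \<mu>] f se)
    then show ?case using maharam_submeasure_onD(1)[OF \<mu> se, of "Suc n"] f Suc by simp
  qed (simp add: s_def f)
  have inc: "incseq s" by (rule incseq_SucI) (simp add: s_Suc)
  have sup: "(SUP n. s n) = Sup A"
  proof (rule antisym)
    have A_eq: "Sup A = (SUP n. f n)" using False A(1) by (simp add: f_def)
    show "(SUP n. s n) \<le> Sup A"
      unfolding A_eq by (auto simp: s_def intro!: SUP_least intro: SUP_upper)
    have "f n \<le> (SUP n. s n)" for n
      by (rule SUP_upper2[of n]) (auto simp: s_def intro: SUP_upper)
    then show "Sup A \<le> (SUP n. s n)" unfolding A_eq by (rule SUP_least)
  qed
  have Ae: "Sup A \<le> e" using A(2) by (intro Sup_least) auto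
  have "null (\<lambda>n. Sup A - s n)" using null_SUP_incseq[OF inc] by (simp add: sup)
  then have lim: "(\<lambda>n. \<mu> (Sup A - s n)) \<longlonglongrightarrow> 0"
    by (intro maharam_submeasure_on_null[OF \<mu>]) (auto simp: diff_eq Ae le_infI1)
  have "\<mu> (Sup A) \<le> \<mu> (Sup A - s n)" for n
  proof -
    have le: "Sup A - s n \<le> e" using Ae by (simp add: diff_eq le_infI1)
    have "Sup A \<le> sup (s n) (Sup A - s n)" by (simp flip: diff_le_iff_le_sup)
    then have "\<mu> (Sup A) \<le> \<mu> (sup (s n) (Sup A - s n))"
      using se le by (intro maharam_submeasure_onD(3)[OF \<mu>]) auto
    also have "\<dots> \<le> \<mu> (s n) + \<mu> (Sup A - s n)"
      using se le by (intro maharam_submeasure_onD(4)[OF \<mu>])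
    finally show ?thesis by (simp add: s0)
  qed
  then have "\<mu> (Sup A) \<le> 0" using lim by (intro LIMSEQ_le_const[of _ 0]) auto
  then show ?thesis using maharam_submeasure_onD(1)[OF \<mu> Ae] by simp
qed (simp add: maharam_submeasure_onD[OF \<mu>])

text \<open>The elements of value 0 lie below the join of a countable antichain of them, which again
  has value 0. What is left of \<open>e\<close> is nonzero because \<open>a\<close> is not below
  that join.\<close>

lemma carries_maharam_of_nonzero:
  fixes e :: "'a::{boolean_algebra,complete_lattice}"
  assumes ccc: "ccc TYPE('a)" and \<mu>: "maharam_submeasure_on e \<mu>" and a: "a \<le> e" "\<mu> a \<noteq> 0"
  shows "\<exists>g\<le>e. g \<noteq> bot \<and> carries_maharam g"
proof -
  let ?Z = "{x. x \<le> e \<and> \<mu> x = 0}"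
  have down: "y \<in> ?Z" if "x \<in> ?Z" "y \<le> x" for x y
  proof -
    have y: "y \<le> e" "\<mu> y \<le> \<mu> x"
      using that maharam_submeasure_onD(3)[OF \<mu>, of x y] by auto
    with maharam_submeasure_onD(1)[OF \<mu> y(1)] that(1) show ?thesis by simp
  qed
  obtain A where A: "A \<subseteq> ?Z" "bot \<notin> A" "pairwise (\<lambda>x y. inf x y = bot) A"
    and max: "\<And>p. p \<in> ?Z \<Longrightarrow> p \<le> Sup A"
    by (rule disjoint_cover[of ?Z], rule down) auto
  have "\<mu> (Sup A) = 0"
    using maharam_null_Sup[OF \<mu> ccc_countable[OF ccc A(2,3)]] A(1) by blast
  have Ae: "Sup A \<le> e" using A(1) by (intro Sup_least) auto
  define g where "g = e - Sup A"
  have ge: "g \<le> e" by (simp add: g_def diff_eq)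
  have "g \<noteq> bot"
  proof
    assume "g = bot"
    then have "a \<le> Sup A" using a(1) by (simp add: g_def)
    then have "\<mu> a \<le> \<mu> (Sup A)" by (rule maharam_submeasure_onD(3)[OF \<mu> Ae])
    then show False using a \<open>\<mu> (Sup A) = 0\<close> maharam_submeasure_onD(1)[OF \<mu> a(1)] by simp
  qed
  moreover have "maharam_submeasure_on g \<mu>"
  proof -
    have le: "x \<le> e" if "x \<le> g" for x using that ge by (rule order_trans)
    then have "{..g} \<subseteq> {..e}" by auto
    then show ?thesis
      using \<mu> le unfolding maharam_submeasure_on_def submeasure_on_def by (meson order_trans)
  qed
  moreover have "strictly_positive_on g \<mu>" unfolding strictly_positive_on_def
  proof (intro allI impI)
    fix x assume x: "x \<le> g" "\<mu> x = 0"
    then have "x \<le> Sup A" using max[of x] ge by (auto intro: order_trans)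
    moreover have "x \<le> - Sup A" using x(1) by (simp add: g_def diff_eq)
    ultimately have "x \<le> inf (Sup A) (- Sup A)" by (rule le_infI)
    then show "x = bot" by (simp only: boolean_algebra.conj_cancel_right bot_unique)
  qed
  ultimately show ?thesis using ge unfolding carries_maharam_def by blast
qed

section \<open>From an open set that is not dense to a submeasure\<close>

lemma symdiff_disjoint:
  assumes "inf x y = bot"
  shows "symdiff x y = sup x y"
proof -
  have "x \<le> - y" "y \<le> - x" using assms by (simp_all add: inf_shunt inf_commute flip: inf_shunt)
  then show ?thesis by (simp add: symdiff_def diff_eq inf_absorb1)
qed

lemma ex_carries_maharam:
  fixes d :: "'a::{boolean_algebra,complete_lattice}"
  assumes ccc: "ccc TYPE('a)" and U: "openin (tau_s d) U" "U \<noteq> {}"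
    and not_dense: "tau_s d closure_of U \<noteq> topspace (tau_s d)"
  shows "\<exists>g\<le>d. g \<noteq> bot \<and> carries_maharam g"
proof -
  define V where "V = topspace (tau_s d) - tau_s d closure_of U"
  have V: "openin (tau_s d) V" unfolding V_def by (simp add: openin_diff)
  obtain u where u: "u \<in> U" using U(2) by blast
  obtain v where v: "v \<in> V"
    using not_dense closure_of_subset_topspace[of "tau_s d" U] unfolding V_def by blast
  obtain w :: 'a where w: "unbounding w" and wd: "weakly_distributive (- w)"
    by (rule greatest_unbounding)
  define e where "e = inf d (- w)"
  have ed: "e \<le> d" by (simp add: e_def)
  have wde: "weakly_distributive e" using wd by (rule weakly_distributive_le) (simp add: e_def)
  have ud: "u \<le> d" and vd: "v \<le> d" using u v U V by (auto intro: openin_tau_s_le)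
  define a where "a = symdiff u v"
  have ad: "a \<le> d" unfolding a_def using symdiff_le ud vd by (meson le_sup_iff order_trans)
  \<comment> \<open>Translating by \<open>x\<close>, the part below \<open>w\<close>, does not lead
    from \<open>U\<close> out of its closure. The separation of \<open>v\<close> from
    \<open>U\<close> is thus due to \<open>y\<close>, which lies in the weakly distributive
    part.\<close>
  define x where "x = inf a w"
  define y where "y = inf a (- w)"
  have xy: "symdiff x y = a"
    unfolding x_def y_def using symdiff.conj_xor_distrib[of a w "- w"] by simp
  have xd: "x \<le> d" "unbounding x" using ad w by (auto simp: x_def le_infI1 intro: unbounding_le)
  have ye: "y \<le> e" using ad by (simp add: y_def e_def le_infI1)
  have nbhd: "openin (tau_s e) {z. z \<le> e \<and> symdiff z b \<in> G}" if "openin (tau_s d) G" "b \<le> d" for G b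
  proof (rule openin_tau_s_vimage[OF that(1)])
    show "symdiff z b \<le> d" if "z \<le> e" for z
      using that ed \<open>b \<le> d\<close> symdiff_le by (meson le_sup_iff order_trans)
  qed simp
  have "openin (tau_s e) ({z. z \<le> e \<and> symdiff z u \<in> U} \<inter> {z. z \<le> e \<and> symdiff z v \<in> V})"
    using nbhd U(1) V ud vd by (intro openin_Int) blast+
  moreover have "bot \<in> {z. z \<le> e \<and> symdiff z u \<in> U} \<inter> {z. z \<le> e \<and> symdiff z v \<in> V}"
    using u v by simp
  ultimately obtain W where W: "solid_nbhd e W"
    and W_sub: "W \<subseteq> {z. z \<le> e \<and> symdiff z u \<in> U} \<inter> {z. z \<le> e \<and> symdiff z v \<in> V}"
    by (rule ex_solid_nbhd[OF ccc wde])
  have "y \<notin> joins W"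
  proof
    assume "y \<in> joins W"
    then obtain p q where pq: "y = sup p q" "p \<in> W" "q \<in> W" by (auto simp: joins_def)
    \<comment> \<open>Making the parts disjoint turns the join into a symmetric difference, whose
      terms can be moved across the equation \<open>symdiff x y = symdiff u v\<close>.\<close>
    define q' where "q' = q - p"
    have q': "q' \<in> W" using solid_nbhdD(3)[OF W pq(3)] by (simp add: q'_def diff_eq)
    have "y = symdiff p q'"
    proof -
      have "inf p q' = bot" by (simp add: q'_def diff_eq inf_left_commute)
      then have "symdiff p q' = sup p q'" by (rule symdiff_disjoint)
      also have "\<dots> = sup p q" by (simp add: q'_def diff_eq sup_inf_distrib1)
      finally show ?thesis using pq(1) by simp
    qed
    then have "symdiff (symdiff q' u) x = symdiff p v"
      using xy unfolding a_def
      by (metis symdiff.xor.assoc symdiff.xor.commute symdiff.xor_left_self)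
    moreover have "symdiff (symdiff q' u) x \<in> tau_s d closure_of U"
      using q' W_sub xd by (intro unbounding_closure U(1)) auto
    moreover have "symdiff p v \<in> V" using pq(2) W_sub by blast
    ultimately show False by (simp add: V_def)
  qed
  then obtain \<mu> where \<mu>: "maharam_submeasure_on e \<mu>" "\<mu> y \<noteq> 0"
    by (rule ex_maharam_submeasure[OF ccc wde W ye])
  show ?thesis using carries_maharam_of_nonzero[OF ccc \<mu>(1) ye \<mu>(2)] ed by (meson order_trans)
qed

theorem mainTheorem1:
  assumes "ccc TYPE('a::{boolean_algebra,complete_lattice})"
  shows "\<exists>d m :: 'a. inf d m = bot \<and> sup d m = top \<and>
    (\<forall>U. openin (tau_s d) U \<and> U \<noteq> {} \<longrightarrow> tau_s d closure_of U = topspace (tau_s d)) \<and>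
    (\<exists>\<mu>. maharam_submeasure_on m \<mu> \<and> strictly_positive_on m \<mu>)"
proof -
  obtain A :: "'a set" where A: "A \<subseteq> Collect carries_maharam" "bot \<notin> A"
      "pairwise (\<lambda>x y. inf x y = bot) A"
    and max: "\<And>p. p \<in> Collect carries_maharam \<Longrightarrow> p \<le> Sup A"
    by (rule disjoint_cover[of "Collect carries_maharam"]) (auto intro: carries_maharam_le)
  define m where "m = Sup A"
  have "carries_maharam m" unfolding m_def
    using carries_maharam_Sup[OF ccc_countable[OF assms A(2,3)]] A(1) by blast
  moreover have "tau_s (- m) closure_of U = topspace (tau_s (- m))"
    if U: "openin (tau_s (- m)) U" "U \<noteq> {}" for U
  proof (rule ccontr)
    assume "tau_s (- m) closure_of U \<noteq> topspace (tau_s (- m))"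
    then obtain g where g: "g \<le> - m" "g \<noteq> bot" "carries_maharam g"
      using ex_carries_maharam[OF assms U] by blast
    then have "g \<le> inf (- m) m" using max[of g] by (intro le_infI) (auto simp: m_def)
    then show False using g(2) by (simp only: boolean_algebra.conj_cancel_left bot_unique)
  qed
  ultimately show ?thesis unfolding carries_maharam_def
    by (intro exI[of _ "- m"] exI[of _ m]) simp
qed

end
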